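(* For all positive integers $r<k$, one has $$\sum_{\boldsymbol{k}=(k_1,\ldots,k_r)\in I_r(k,r)}2^{k_r}\,\zeta^{\frac12}(\boldsymbol{k})=\frac{1}{2^{r-2}}\left\{2^{k-1}-1+\sum_{n=0}^{r-1}\binom{k-1}{n}\right\}\zeta(k).$$
   Context: An index is a finite tuple $\boldsymbol{k}=(k_1,\ldots,k_r)$ of positive integers; $\mathrm{wt}(\boldsymbol{k})=k_1+\cdots+k_r$ and $\mathrm{dep}(\boldsymbol{k})=r$. For $k_r\ge 2$ the multiple zeta value is $\zeta(k_1,\ldots,k_r)=\sum_{0<n_1<\cdots<n_r}\frac{1}{n_1^{k_1}\cdots n_r^{k_r}}\in\mathbb{R}$. For indices write $\boldsymbol{l}\preceq\boldsymbol{k}$ if $\boldsymbol{l}$ is of the form $(k_1\,\square\,k_2\,\square\cdots\square\,k_r)$ where each of the $r-1$ boxes is filled with a comma "," or a plus "+"; sums over $\boldsymbol{l}\preceq\boldsymbol{k}$ run over all $2^{r-1}$ choices. For $\boldsymbol{k}$ with $k_r\ge2$ the interpolated multiple zeta value is $\zeta^{t}(\boldsymbol{k})=\sum_{\boldsymbol{l}\preceq\boldsymbol{k}}\zeta(\boldsymbol{l})\,t^{r-\mathrm{dep}(\boldsymbol{l})}$, and $\zeta^{\frac12}(\boldsymbol{k})$ is its value at $t=\frac12$. For positive integers $i\le r<k$, $I_i(k,r)$ is the set of indices $\boldsymbol{k}=(k_1,\ldots,k_r)$ with $\mathrm{wt}(\boldsymbol{k})=k$, $\mathrm{dep}(\boldsymbol{k})=r$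 and $k_i\ge2$. *)

theory Defs
  imports "HOL-Analysis.Analysis"
begin

text \<open>
  An index (k_1, ..., k_r) is a list of positive naturals. List positions start at 0,
  so the entry k_i is \<open>ks ! (i - 1)\<close>.
\<close>

definition is_index :: "nat list \<Rightarrow> bool" where
  "is_index ks \<longleftrightarrow> (\<forall>k \<in> set ks. 0 < k)"

abbreviation wt :: "nat list \<Rightarrow> nat" where
  "wt ks \<equiv> sum_list ks"

abbreviation dep :: "nat list \<Rightarrow> nat" where
  "dep ks \<equiv> length ks"

text \<open>
  The order convention is 0 < n_1 < ... < n_r, so the series converges for indices
  whose last entry is at least 2. Where it diverges, the value is the default 0 of
  \<^const>\<open>infsum\<close>.
\<close>

definition mzv :: "nat list \<Rightarrow> real" where
  "mzv ks =
     (\<Sum>\<^sub>\<infinity>ns \<in> {ns. length ns = dep ks \<and> sorted_wrt (<) ns \<and> (\<forall>n \<in> set ns. 0 < n)}.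
        1 / (\<Prod>i<dep ks. real (ns ! i) ^ (ks ! i)))"

text \<open>
  \<open>fill ks bs\<close> is the index (k_1 b_1 k_2 b_2 ... b_(r-1) k_r), where consecutive entries
  separated by \<open>Plus\<close> are added up. It is used only with \<open>length bs = dep ks - 1\<close>,
  so the third equation, which keeps all remaining commas, is never reached.
\<close>

datatype box = Comma | Plus

fun fill :: "nat list \<Rightarrow> box list \<Rightarrow> nat list" where
  "fill [] bs = []"
| "fill [k] bs = [k]"
| "fill (k # k' # ks) [] = k # k' # ks"
| "fill (k # k' # ks) (Comma # bs) = k # fill (k' # ks) bs"
| "fill (k # k' # ks) (Plus # bs) = fill ((k + k') # ks) bs"

definition interpolated_mzv :: "real \<Rightarrow> nat list \<Rightarrow> real" where
  "interpolated_mzv t ks =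
     (\<Sum>bs \<in> {bs :: box list. length bs = dep ks - 1}.
        mzv (fill ks bs) * t ^ (dep ks - dep (fill ks bs)))"

definition index_set :: "nat \<Rightarrow> nat \<Rightarrow> nat \<Rightarrow> nat list set" where
  "index_set i k r = {ks. is_index ks \<and> wt ks = k \<and> dep ks = r \<and> ks ! (i - 1) \<ge> 2}"

lemma UNIV_box: "(UNIV :: box set) = {Comma, Plus}"
  by (auto intro: box.exhaust)

lemma card_fillings:
  "finite {bs :: box list. length bs = n}" "card {bs :: box list. length bs = n} = 2 ^ n"
  using finite_lists_length_eq[of "UNIV :: box set" n] card_lists_length_eq[of "UNIV :: box set" n]
  by (simp_all add: UNIV_box[symmetric]) (simp_all add: UNIV_box numeral_2_eq_2)

lemma finite_index_set: "finite (index_set i k r)"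
proof (rule finite_subset)
  show "index_set i k r \<subseteq> {ks. set ks \<subseteq> {..k} \<and> length ks = r}"
    by (auto simp: index_set_def intro: member_le_sum_list)
  show "finite {ks. set ks \<subseteq> {..k} \<and> length ks = r}"
    by (rule finite_lists_length_eq) simp
qed

end

theory Submission
  imports Defs "HOL-Real_Asymp.Real_Asymp" "HOL-Complex_Analysis.Cauchy_Integral_Formula"
begin

text \<open>
  The proof compares two-variable generating functions. Let \<open>x\<close> mark weight minus depth and
  \<open>y = 2 z\<close> mark depth. Unfolding \<open>\<preceq>\<close> turns \<open>\<zeta>\<^sup>t(k\<^sub>1, \<dots>, k\<^sub>r)\<close> into a sum over weakly
  increasing tuples \<open>n\<^sub>1 \<le> \<dots> \<le> n\<^sub>r\<close> in which every equality \<open>n\<^sub>i = n\<^bsub>i+1\<^esub>\<close> costs a factor \<open>t\<close>.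
  Summing over all exponents makes the contributions of the different integers \<open>m\<close> independent.
  At \<open>t = 1/2\<close> an integer \<open>m\<close> below the largest one contributes
  \<open>1 + U\<^sub>m / (1 - t U\<^sub>m) = (m - x + z) / (m - x - z)\<close>, where \<open>U\<^sub>m = y / (m - x)\<close>. The largest one,
  \<open>n\<close>, also carries the weight \<open>2\<close> to the power of the last entry, and the generating function of
  the left-hand sides becomes
  \[ \sum_n \frac{8 x z}{n (n - 2 x)} \cdot \frac{n - x}{n - x - z}
       \prod_{m < n} \frac{m - x + z}{m - x - z}. \]
  These are the lemmas \<open>interp_tail_eq_weak_tail\<close>, \<open>interp_tail_snoc\<close> and \<open>infsum_admissible\<close>.

  The factor \<open>2\<close> to the power of the last entry is what makes the series summable in closed form:
  it produces \<open>2 (n - x) / (n (n - 2 x)) = 1/n + 1/(n - 2 x)\<close>, and with \<open>a = z - x\<close> and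
  \<open>b = 1 - x - z\<close> the series splits into \<open>4 x z / a\<close> times
  \<open>\<Sum>\<^sub>n (a)\<^sub>n / (b)\<^sub>n \<cdot> 1/n\<close> and \<open>\<Sum>\<^sub>n (a)\<^sub>n / (b)\<^sub>n \<cdot> 1/(n - 2 x)\<close>, where \<open>(a)\<^sub>n\<close> is the
  rising factorial and \<open>1 - 2 x = a + b\<close>. When \<open>b\<close> grows by one, the first sum
  changes by an elementary fraction, and the second one, where \<open>a + b\<close> grows along, becomes an
  elementary fraction minus itself shifted, because the combined terms telescope in \<open>n\<close>.
  Iterating the shift turns the sums into
  \<open>\<Sum>\<^sub>m (1 / (b - a + m) - 1 / (b + m))\<close> and \<open>\<Sum>\<^sub>m (-1)\<^sup>m (1 / (b - a + m) - 1 / (b + a + m))\<close>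
  (lemmas \<open>poch_series_nonalternating\<close> and \<open>poch_series_alternating\<close>). Geometric expansion of these
  fractions gives values \<open>\<zeta>(k)\<close>, since the alternating series \<open>\<Sum> (-1)\<^sup>m / (m + 1)\<^sup>k\<close> is a multiple
  of \<open>\<zeta>(k)\<close>. Summation by parts identifies the coefficient polynomials with the partial binomial
  sums of the theorem (lemma \<open>binomial_partial_sum_telescope\<close>).

  All terms of the generating function are nonnegative for \<open>0 < x < z < 1/2\<close>, so the rearrangements
  take place in the extended nonnegative reals, where sums may be exchanged freely. The finite
  closed form then shows that every series occurring in it converges, and coefficients can be
  compared, first along rays \<open>(s x, s z)\<close>, then in \<open>x\<close>.
\<close>

section \<open>Unordered sums in the extended nonnegative reals\<close>

lemma ennreal_summable_on [simp]: "(f :: 'a \<Rightarrow> ennreal) summable_on A"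
  by (rule nonneg_summable_on_complete) simp

lemma ennreal_finite_sum_le_infsum:
  fixes f :: "'a \<Rightarrow> ennreal"
  assumes "finite F" "F \<subseteq> A"
  shows "sum f F \<le> infsum f A"
  using assms by (simp add: nonneg_infsum_complete SUP_upper)

text \<open>
  Tonelli's theorem for sums: each side is the supremum of its finite partial sums, and every finite
  partial sum of one side is dominated by the other side.
\<close>

lemma infsum_ennreal_Sigma:
  fixes f :: "'a \<Rightarrow> 'b \<Rightarrow> ennreal"
  shows "(\<Sum>\<^sub>\<infinity>x\<in>A. \<Sum>\<^sub>\<infinity>y\<in>B x. f x y) = (\<Sum>\<^sub>\<infinity>(x, y)\<in>Sigma A B. f x y)"
proof (rule antisym)
  have "(\<Sum>x\<in>F. \<Sum>\<^sub>\<infinity>y\<in>B x. f x y) \<le> (\<Sum>\<^sub>\<infinity>(x, y)\<in>Sigma A B. f x y)"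
    if "finite F" "F \<subseteq> A" for F
  proof -
    have "(\<Sum>x\<in>F. \<Sum>\<^sub>\<infinity>y\<in>B x. f x y) = (\<Sum>\<^sub>\<infinity>(x, y)\<in>Sigma F B. f x y)"
      using that(1)
    proof (induction F)
      case (insert x F)
      have "Sigma (insert x F) B = Pair x ` B x \<union> Sigma F B"
        by auto
      moreover have "Pair x ` B x \<inter> Sigma F B = {}"
        using insert by auto
      ultimately have "(\<Sum>\<^sub>\<infinity>(x, y)\<in>Sigma (insert x F) B. f x y)
          = (\<Sum>\<^sub>\<infinity>(x, y)\<in>Pair x ` B x. f x y) + (\<Sum>\<^sub>\<infinity>(x, y)\<in>Sigma F B. f x y)"
        by (simp add: infsum_Un_disjoint ennreal_summable_on)
      also have "(\<Sum>\<^sub>\<infinity>(x, y)\<in>Pair x ` B x. f x y) = (\<Sum>\<^sub>\<infinity>y\<in>B x. f x y)"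
        by (subst infsum_reindex) (auto simp: inj_on_def o_def)
      finally show ?case using insert by simp
    qed simp
    also have "\<dots> \<le> (\<Sum>\<^sub>\<infinity>(x, y)\<in>Sigma A B. f x y)"
      using that by (intro infsum_mono_neutral ennreal_summable_on) auto
    finally show ?thesis .
  qed
  then show "(\<Sum>\<^sub>\<infinity>x\<in>A. \<Sum>\<^sub>\<infinity>y\<in>B x. f x y) \<le> (\<Sum>\<^sub>\<infinity>(x, y)\<in>Sigma A B. f x y)"
    by (intro infsum_le_finite_sums ennreal_summable_on)
next
  have "(\<Sum>(x, y)\<in>F. f x y) \<le> (\<Sum>\<^sub>\<infinity>x\<in>A. \<Sum>\<^sub>\<infinity>y\<in>B x. f x y)"
    if F: "finite F" "F \<subseteq> Sigma A B" for F
  proof -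
    have "F = Sigma (fst ` F) (\<lambda>x. {y. (x, y) \<in> F})"
      by force
    moreover have "finite {y. (x, y) \<in> F}" for x
      by (rule finite_subset[of _ "snd ` F"]) (use F in force)+
    ultimately have "(\<Sum>(x, y)\<in>F. f x y) = (\<Sum>x\<in>fst ` F. \<Sum>y\<in>{y. (x, y) \<in> F}. f x y)"
      using F by (subst sum.Sigma) auto
    also have "\<dots> \<le> (\<Sum>x\<in>fst ` F. \<Sum>\<^sub>\<infinity>y\<in>B x. f x y)"
      using F \<open>\<And>x. finite {y. (x, y) \<in> F}\<close>
      by (intro sum_mono ennreal_finite_sum_le_infsum) auto
    also have "\<dots> \<le> (\<Sum>\<^sub>\<infinity>x\<in>A. \<Sum>\<^sub>\<infinity>y\<in>B x. f x y)"
      using F by (intro ennreal_finite_sum_le_infsum) auto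
    finally show ?thesis .
  qed
  then show "(\<Sum>\<^sub>\<infinity>(x, y)\<in>Sigma A B. f x y) \<le> (\<Sum>\<^sub>\<infinity>x\<in>A. \<Sum>\<^sub>\<infinity>y\<in>B x. f x y)"
    by (intro infsum_le_finite_sums ennreal_summable_on)
qed

lemma infsum_ennreal_swap:
  fixes f :: "'a \<Rightarrow> 'b \<Rightarrow> ennreal"
  shows "(\<Sum>\<^sub>\<infinity>x\<in>A. \<Sum>\<^sub>\<infinity>y\<in>B. f x y) = (\<Sum>\<^sub>\<infinity>y\<in>B. \<Sum>\<^sub>\<infinity>x\<in>A. f x y)"
  unfolding infsum_ennreal_Sigma
  by (rule infsum_reindex_bij_witness[of _ "\<lambda>(y, x). (x, y)" "\<lambda>(x, y). (y, x)"]) auto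

lemma infsum_ennreal_cmult:
  fixes f :: "'a \<Rightarrow> ennreal"
  shows "(\<Sum>\<^sub>\<infinity>x\<in>A. c * f x) = c * (\<Sum>\<^sub>\<infinity>x\<in>A. f x)"
  by (simp add: nonneg_infsum_complete SUP_mult_left_ennreal sum_distrib_left)

lemma infsum_ennreal_multc:
  fixes f :: "'a \<Rightarrow> ennreal"
  shows "(\<Sum>\<^sub>\<infinity>x\<in>A. f x * c) = (\<Sum>\<^sub>\<infinity>x\<in>A. f x) * c"
  using infsum_ennreal_cmult[of c f A] by (simp add: mult.commute)

lemma infsum_ennreal_add:
  fixes f g :: "'a \<Rightarrow> ennreal"
  shows "(\<Sum>\<^sub>\<infinity>x\<in>A. f x + g x) = (\<Sum>\<^sub>\<infinity>x\<in>A. f x) + (\<Sum>\<^sub>\<infinity>x\<in>A. g x)"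
  by (rule infsum_add) (rule ennreal_summable_on)+

lemma infsum_ennreal_sum:
  fixes f :: "'i \<Rightarrow> 'a \<Rightarrow> ennreal"
  assumes "finite I"
  shows "(\<Sum>\<^sub>\<infinity>x\<in>A. \<Sum>i\<in>I. f i x) = (\<Sum>i\<in>I. \<Sum>\<^sub>\<infinity>x\<in>A. f i x)"
  using assms by (induction I) (auto simp: infsum_ennreal_add)

lemma ennreal_sums:
  assumes "f sums s" "\<And>n. 0 \<le> f n"
  shows "(\<lambda>n. ennreal (f n)) sums ennreal s"
proof -
  have "0 \<le> s" by (rule sums_le[OF _ sums_zero assms(1)]) (rule assms(2))
  with assms show ?thesis by (simp add: sums_ennreal)
qed

lemma infsum_ennreal_suminf:
  fixes f :: "nat \<Rightarrow> ennreal"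
  shows "(\<Sum>\<^sub>\<infinity>n. f n) = (\<Sum>n. f n)"
  by (metis has_sum_imp_sums has_sum_infsum sums_unique ennreal_summable_on)

lemma infsum_ennreal_suminf_Suc:
  fixes f :: "nat \<Rightarrow> ennreal"
  shows "(\<Sum>\<^sub>\<infinity>n\<in>{0<..}. f n) = (\<Sum>n. f (Suc n))"
proof -
  have "bij_betw Suc UNIV {0<..}"
    by (rule bij_betwI[where g = "\<lambda>n. n - 1"]) auto
  then have "(\<Sum>\<^sub>\<infinity>n\<in>{0<..}. f n) = (\<Sum>\<^sub>\<infinity>n. f (Suc n))"
    by (rule infsum_reindex_bij_betw[symmetric])
  then show ?thesis by (simp add: infsum_ennreal_suminf)
qed

text \<open>
  The passage back to real sums. A real sum that diverges has the default value \<open>0\<close>, hence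
  finiteness of the extended sum must be known first.
\<close>

lemma ennreal_infsum:
  assumes "\<And>x. x \<in> A \<Longrightarrow> 0 \<le> f x" and fin: "(\<Sum>\<^sub>\<infinity>x\<in>A. ennreal (f x)) \<noteq> top"
  shows "ennreal (infsum f A) = (\<Sum>\<^sub>\<infinity>x\<in>A. ennreal (f x))"
proof -
  have "f summable_on A"
  proof (rule nonneg_bdd_above_summable_on)
    show "bdd_above (sum f ` {F. F \<subseteq> A \<and> finite F})"
    proof (rule bdd_aboveI2)
      fix F assume F: "F \<in> {F. F \<subseteq> A \<and> finite F}"
      have "ennreal (sum f F) = (\<Sum>x\<in>F. ennreal (f x))"
        using F assms(1) by (subst sum_ennreal) auto
      also have "\<dots> \<le> (\<Sum>\<^sub>\<infinity>x\<in>A. ennreal (f x))"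
        using F by (intro ennreal_finite_sum_le_infsum) auto
      finally have "enn2real (ennreal (sum f F)) \<le> enn2real (\<Sum>\<^sub>\<infinity>x\<in>A. ennreal (f x))"
        using fin by (intro enn2real_mono) (auto simp: less_top)
      moreover have "0 \<le> sum f F"
        using F assms(1) by (auto intro: sum_nonneg)
      ultimately show "sum f F \<le> enn2real (\<Sum>\<^sub>\<infinity>x\<in>A. ennreal (f x))"
        by simp
    qed
  qed (use assms in auto)
  then have "ennreal (infsum f A) = (SUP F\<in>{F. finite F \<and> F \<subseteq> A}. ennreal (sum f F))"
    using assms by (intro infsum_nonneg_is_SUPREMUM_ennreal) auto
  also have "\<dots> = (SUP F\<in>{F. finite F \<and> F \<subseteq> A}. \<Sum>x\<in>F. ennreal (f x))"
    using assms by (intro SUP_cong refl) (auto intro!: sum_ennreal[symmetric])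
  finally show ?thesis by (simp add: nonneg_infsum_complete)
qed

section \<open>Two series of ratios of rising factorials\<close>

text \<open>
  By Euler's limit formula for \<open>1 / \<Gamma>\<close>, the ratio behaves like
  \<open>n\<^bsup>a - b\<^esup> \<Gamma>(b) / \<Gamma>(a)\<close>.
\<close>

lemma pochhammer_ratio_tendsto_0:
  fixes a b :: real
  assumes "0 < a" "a < b"
  shows "(\<lambda>n. pochhammer a n / pochhammer b n) \<longlonglongrightarrow> 0"
proof -
  have "(\<lambda>n. rGamma_series a n / rGamma_series b n * real n powr (a - b)) \<longlonglongrightarrow> rGamma a / rGamma b * 0"
    using assms
    by (intro tendsto_mult tendsto_divide rGamma_series_LIMSEQ tendsto_neg_powr filterlim_real_sequentially)
       (auto simp: rGamma_eq_zero_iff nonpos_Ints_def)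
  moreover have "\<forall>\<^sub>F n in sequentially. rGamma_series a n / rGamma_series b n * real n powr (a - b)
     = pochhammer a (Suc n) / pochhammer b (Suc n)"
    using eventually_gt_at_top[of 0]
  proof eventually_elim
    case (elim n)
    then have "exp (b * ln (real n)) \<noteq> 0" by simp
    with elim show ?case
      by (simp add: rGamma_series_def powr_def field_simps exp_diff)
  qed
  ultimately have "(\<lambda>n. pochhammer a (Suc n) / pochhammer b (Suc n)) \<longlonglongrightarrow> 0"
    by (simp add: tendsto_cong)
  then show ?thesis by (subst (asm) filterlim_sequentially_Suc)
qed

text \<open>
  The summand is the difference of consecutive values of \<open>(a)\<^sub>n / ((b)\<^sub>n (b - a))\<close>. Besides the
  evaluation, this gives the summability of all series considered below, by comparison.
\<close>

lemma pochhammer_telescope_sums: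
  fixes a b :: real
  assumes "0 < a" "a < b"
  shows "(\<lambda>n. pochhammer a (Suc n) / pochhammer b (Suc (Suc n))) sums (1 / (b - a) - 1 / b)"
proof -
  define s where "s n = pochhammer a (Suc n) / pochhammer b (Suc n) / (b - a)" for n
  have "s \<longlonglongrightarrow> 0 / (b - a)"
    unfolding s_def using filterlim_sequentially_Suc[THEN iffD2, OF pochhammer_ratio_tendsto_0[OF assms]]
    using assms by (intro tendsto_divide) auto
  then have "(\<lambda>n. s n - s (Suc n)) sums (s 0 - 0)"
    by (intro telescope_sums') simp
  moreover have "s n - s (Suc n) = pochhammer a (Suc n) / pochhammer b (Suc (Suc n))" for n
  proof -
    have "pochhammer b (Suc n) > 0" "b + real (Suc n) > 0"
      using assms by (auto intro: pochhammer_pos)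
    then show ?thesis using assms
      unfolding s_def pochhammer_Suc[of a "Suc n"] pochhammer_Suc[of b "Suc n"]
      by (simp add: divide_simps del: of_nat_Suc) (simp add: algebra_simps)
  qed
  moreover have "s 0 = 1 / (b - a) - 1 / b"
    using assms by (simp add: s_def field_simps)
  ultimately show ?thesis by simp
qed

lemma pochhammer_ratio_shift:
  fixes a b :: real
  assumes "0 < a" "a < b" "0 \<le> c"
  shows "pochhammer a (Suc n) / pochhammer (b + c) (Suc n)
     \<le> b / (b + c) * (pochhammer a (Suc n) / pochhammer b (Suc n))"
proof -
  have "pochhammer (b + 1) n \<le> pochhammer (b + c + 1) n"
    unfolding pochhammer_prod using assms by (intro prod_mono) auto
  moreover have "pochhammer (b + 1) n > 0" "pochhammer (b + c + 1) n > 0" "pochhammer a (Suc n) > 0"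
    using assms by (auto intro!: pochhammer_pos)
  ultimately show ?thesis using assms
    by (simp add: pochhammer_rec[of b n] pochhammer_rec[of "b+c" n] divide_simps del: pochhammer_Suc)
qed

text \<open>
  Up to normalisation a hypergeometric series \<open>\<^sub>3F\<^sub>2\<close> at argument \<open>1\<close>. The index is shifted by one, so
  \<open>d = 1\<close> stands for the factor \<open>1/n\<close> and \<open>d = 1 - 2 x\<close> for \<open>1 / (n - 2 x)\<close>.
\<close>

definition poch_series :: "real \<Rightarrow> real \<Rightarrow> real \<Rightarrow> real" where
  "poch_series d a b = (\<Sum>n. pochhammer a (Suc n) / pochhammer b (Suc n) / (d + real n))"

lemma summable_poch_series:
  assumes "0 < a" "a < b" "0 < d"
  shows "summable (\<lambda>n. pochhammer a (Suc n) / pochhammer b (Suc n) / (d + real n))"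
proof (rule summable_comparison_test')
  show "summable (\<lambda>n. ((b + 1) / d + 1) * (pochhammer a (Suc n) / pochhammer b (Suc (Suc n))))"
    using pochhammer_telescope_sums[OF assms(1,2)] by (intro summable_mult) (rule sums_summable)
next
  fix n :: nat
  have pos: "pochhammer a (Suc n) > 0" "pochhammer b (Suc n) > 0" 
    using assms by (auto intro!: pochhammer_pos)
  have "1 / (d + real n) \<le> ((b + 1) / d + 1) / (b + 1 + real n)"
  proof -
    have "b + 1 + real n \<le> ((b + 1) / d + 1) * (d + real n)"
    proof -
      have "(b + 1) / d * d \<le> (b + 1) / d * (d + real n)"
        using assms by (intro mult_left_mono) auto
      then have "b + 1 \<le> (b + 1) / d * (d + real n)"
        using assms by simp
      moreover have "((b + 1) / d + 1) * (d + real n) = (b + 1) / d * (d + real n) + (d + real n)"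
        by (simp only: distrib_right mult_1)
      ultimately show ?thesis
        using \<open>0 < d\<close> by simp
    qed
    then show ?thesis using assms by (simp add: pos_divide_le_eq pos_le_divide_eq)
  qed
  then have "pochhammer a (Suc n) / pochhammer b (Suc n) * (1 / (d + real n))
     \<le> pochhammer a (Suc n) / pochhammer b (Suc n) * (((b + 1) / d + 1) / (b + 1 + real n))"
    using pos by (intro mult_left_mono) auto
  then show "norm (pochhammer a (Suc n) / pochhammer b (Suc n) / (d + real n))
    \<le> ((b + 1) / d + 1) * (pochhammer a (Suc n) / pochhammer b (Suc (Suc n)))"
    using pos assms unfolding pochhammer_Suc[of b "Suc n"] 
    by (simp add: ac_simps del: pochhammer_Suc)
qed

text \<open>
  Replacing \<open>b\<close> by \<open>b + m\<close> divides every term by at least \<open>(b + m) / b\<close>, so the series is squeezed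
  to \<open>0\<close>. This makes the iterated shifts below converge.
\<close>

lemma poch_series_shift_tendsto_0:
  assumes "0 < a" "a < b" "0 < d" "0 \<le> q"
  shows "(\<lambda>m. poch_series (d + q * real m) a (b + real m)) \<longlonglongrightarrow> 0"
proof (rule tendsto_sandwich)
  show "\<forall>\<^sub>F m in sequentially. 0 \<le> poch_series (d + q * real m) a (b + real m)"
    using assms unfolding poch_series_def
    by (intro always_eventually allI suminf_nonneg summable_poch_series divide_nonneg_nonneg pochhammer_nonneg)
       (auto simp: add_pos_nonneg)
  show "\<forall>\<^sub>F m in sequentially. poch_series (d + q * real m) a (b + real m) \<le> b / (b + real m) * poch_series d a b"
  proof (intro always_eventually allI)
    fix m
    have "poch_series (d + q * real m) a (b + real m)
        \<le> (\<Sum>n. b / (b + real m) * (pochhammer a (Suc n) / pochhammer b (Suc n) / (d + real n)))"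
      unfolding poch_series_def
    proof (rule suminf_le)
      fix n
      have "pochhammer a (Suc n) / pochhammer (b + real m) (Suc n) / (d + q * real m + real n)
        \<le> (b / (b + real m) * (pochhammer a (Suc n) / pochhammer b (Suc n))) / (d + real n)"
        using assms pochhammer_ratio_shift[OF assms(1,2), of "real m" n]
        by (intro frac_le mult_nonneg_nonneg divide_nonneg_nonneg pochhammer_nonneg) auto
      then show "pochhammer a (Suc n) / pochhammer (b + real m) (Suc n) / (d + q * real m + real n)
        \<le> b / (b + real m) * (pochhammer a (Suc n) / pochhammer b (Suc n) / (d + real n))"
        by (simp only: times_divide_eq_right)
    qed (use assms in \<open>intro summable_poch_series summable_mult; auto simp: add_pos_nonneg\<close>)+
    also have "\<dots> = b / (b + real m) * poch_series d a b"
      unfolding poch_series_def using assms by (intro suminf_mult summable_poch_series)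
    finally show "poch_series (d + q * real m) a (b + real m) \<le> b / (b + real m) * poch_series d a b" .
  qed
  have "(\<lambda>m. b / (b + real m)) \<longlonglongrightarrow> 0"
    by real_asymp
  from tendsto_mult_right[OF this, of "poch_series d a b"]
  show "(\<lambda>m. b / (b + real m) * poch_series d a b) \<longlonglongrightarrow> 0" by simp
qed auto

text \<open>
  The value is \<open>\<psi>(b) - \<psi>(b - a)\<close> for the digamma function \<open>\<psi>\<close>. In the difference of the series
  for \<open>b\<close> and \<open>b + 1\<close> the denominator \<open>1 + n\<close> cancels from each term, and what remains is the
  telescoping series above.
\<close>

lemma poch_series_nonalternating:
  assumes "0 < a" "a < b"
  shows "(\<lambda>m. 1 / (b - a + real m) - 1 / (b + real m)) sums poch_series 1 a b"
proof -
  define F where "F m = poch_series 1 a (b + real m)" for m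
  have "(\<lambda>m. F m - F (Suc m)) sums (F 0 - 0)"
    using poch_series_shift_tendsto_0[OF assms, of 1 0] by (intro telescope_sums') (simp add: F_def)
  moreover have "F m - F (Suc m) = 1 / (b - a + real m) - 1 / (b + real m)" for m
  proof -
    define c where "c = b + real m"
    have c: "a < c" "0 < c" using assms by (auto simp: c_def)
    have "F m - F (Suc m) = poch_series 1 a c - poch_series 1 a (c + 1)"
      by (simp add: F_def c_def add_ac)
    also have "\<dots> = (\<Sum>n. pochhammer a (Suc n) / pochhammer c (Suc n) / (1 + real n)
       - pochhammer a (Suc n) / pochhammer (c + 1) (Suc n) / (1 + real n))"
      unfolding poch_series_def using assms c by (intro suminf_diff summable_poch_series) auto
    also have "\<dots> = (\<Sum>n. pochhammer a (Suc n) / pochhammer c (Suc (Suc n)))"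
    proof (intro suminf_cong)
      fix n
      define P where "P = pochhammer (c + 1) n"
      have "P > 0" using c by (auto simp: P_def intro!: pochhammer_pos)
      have "pochhammer c (Suc n) = c * P" "pochhammer (c + 1) (Suc n) = P * (c + 1 + real n)"
        "pochhammer c (Suc (Suc n)) = c * P * (c + 1 + real n)"
        by (simp_all only: P_def pochhammer_rec[of c] pochhammer_Suc[of "c + 1"] mult.assoc)
      with c \<open>P > 0\<close> show "pochhammer a (Suc n) / pochhammer c (Suc n) / (1 + real n)
       - pochhammer a (Suc n) / pochhammer (c + 1) (Suc n) / (1 + real n)
        = pochhammer a (Suc n) / pochhammer c (Suc (Suc n))"
        by (simp add: divide_simps) (simp add: algebra_simps)
    qed
    also have "\<dots> = 1 / (c - a) - 1 / c"
      using pochhammer_telescope_sums[of a c] assms c by (simp add: sums_iff)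
    finally show ?thesis by (simp add: c_def algebra_simps)
  qed
  ultimately show ?thesis by (simp add: F_def)
qed

text \<open>
  Here shifting \<open>b\<close> also shifts the linear factor, and it is the sum of two neighbouring series, not
  their difference, that telescopes in \<open>n\<close>. The antidifference is \<open>s\<close>; the two poles of the summand in
  \<open>n\<close> force its part \<open>1 / (c + a + n)\<close>, and the constant \<open>1 / (c - a)\<close> absorbs what is left.
\<close>

lemma poch_series_adjacent_shifts:
  assumes "0 < a" "a < c"
  shows "poch_series (c + a) a c + poch_series (c + a + 1) a (c + 1) = 1 / (c - a) - 1 / (c + a)"
proof -
  define s where "s n = pochhammer a (Suc n) / pochhammer c (Suc n) * (1 / (c + a + real n) + 1 / (c - a))" for n
  have "s \<longlonglongrightarrow> 0 * (0 + 1 / (c - a))"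
    unfolding s_def
  proof (intro tendsto_mult tendsto_add tendsto_const)
    show "(\<lambda>n. pochhammer a (Suc n) / pochhammer c (Suc n)) \<longlonglongrightarrow> 0"
      using filterlim_sequentially_Suc[THEN iffD2, OF pochhammer_ratio_tendsto_0[OF assms]] .
    show "(\<lambda>n. 1 / (c + a + real n)) \<longlonglongrightarrow> 0" by real_asymp
  qed
  then have "(\<lambda>n. s n - s (Suc n)) sums (s 0 - 0)"
    by (intro telescope_sums') simp
  moreover have "s n - s (Suc n) = pochhammer a (Suc n) / pochhammer c (Suc n) / (c + a + real n)
     + pochhammer a (Suc n) / pochhammer (c + 1) (Suc n) / (c + a + 1 + real n)" for n
  proof -
    define P where "P = pochhammer (c + 1) n"
    define Q where "Q = pochhammer a (Suc n)"
    define e where "e = c + a + real n"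
    define f where "f = c + 1 + real n"
    have "P > 0" "c > 0" using assms by (auto simp: P_def intro!: pochhammer_pos)
    have e: "e > 0" "e + 1 > 0" "f > 0" "c - a > 0" using assms by (auto simp: e_def f_def)
    have eqs: "pochhammer c (Suc n) = c * P" "pochhammer (c + 1) (Suc n) = P * f"
      "pochhammer c (Suc (Suc n)) = c * P * f" "pochhammer a (Suc (Suc n)) = Q * (a + 1 + real n)"
      unfolding P_def Q_def f_def pochhammer_rec[of c] pochhammer_Suc[of "c + 1"]
        pochhammer_Suc[of a "Suc n"] by (simp_all only: mult.assoc of_nat_Suc add.assoc add.commute[of 1])
    have "s n - s (Suc n) = Q / (c * P * f) * (f * (1 / e + 1 / (c - a))
        - (a + 1 + real n) * (1 / (e + 1) + 1 / (c - a)))"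
      unfolding s_def eqs Q_def[symmetric] using \<open>P > 0\<close> \<open>c > 0\<close> e
      by (simp add: e_def divide_simps add_ac) (simp add: algebra_simps)
    also have "f * (1 / e + 1 / (c - a)) - (a + 1 + real n) * (1 / (e + 1) + 1 / (c - a))
       = f / e - (a + 1 + real n) / (e + 1) + (f - (a + 1 + real n)) / (c - a)"
      by (simp add: algebra_simps diff_divide_distrib add_divide_distrib)
    also have "f - (a + 1 + real n) = c - a"
      by (simp add: f_def)
    also have "f / e - (a + 1 + real n) / (e + 1) + (c - a) / (c - a) = f / e + c / (e + 1)"
    proof -
      have "(a + 1 + real n) / (e + 1) + c / (e + 1) = 1"
        using e by (simp flip: add_divide_distrib) (simp add: e_def)
      then show ?thesis using e by simp
    qed
    also have "Q / (c * P * f) * (f / e + c / (e + 1)) = Q / (c * P) / e + Q / (P * f) / (e + 1)"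
      using \<open>P > 0\<close> \<open>c > 0\<close> e by (simp add: distrib_left)
    finally show ?thesis
      unfolding eqs Q_def[symmetric] by (simp add: e_def add_ac)
  qed
  ultimately have "(\<lambda>n. pochhammer a (Suc n) / pochhammer c (Suc n) / (c + a + real n)
     + pochhammer a (Suc n) / pochhammer (c + 1) (Suc n) / (c + a + 1 + real n)) sums s 0"
    by simp
  moreover have "s 0 = 1 / (c - a) - 1 / (c + a)"
    using assms by (simp add: s_def divide_simps)
  ultimately show ?thesis
    unfolding poch_series_def using assms
    by (subst suminf_add) (intro summable_poch_series | simp add: sums_iff)+
qed

lemma poch_series_alternating:
  assumes "0 < a" "a < b"
  shows "(\<lambda>m. (-1) ^ m * (1 / (b - a + real m) - 1 / (b + a + real m))) sums poch_series (b + a) a b"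
proof -
  define F where "F m = (-1) ^ m * poch_series (b + a + real m) a (b + real m)" for m
  have "(\<lambda>m. poch_series (b + a + 1 * real m) a (b + real m)) \<longlonglongrightarrow> 0"
    using assms by (intro poch_series_shift_tendsto_0) auto
  then have "F \<longlonglongrightarrow> 0"
    by (rule tendsto_rabs_zero_cancel[OF tendsto_cong[THEN iffD1, rotated, OF tendsto_rabs_zero]])
       (auto simp: F_def abs_mult)
  then have "(\<lambda>m. F m - F (Suc m)) sums (F 0 - 0)"
    by (rule telescope_sums')
  moreover have "F m - F (Suc m) = (-1) ^ m * (1 / (b - a + real m) - 1 / (b + a + real m))" for m
  proof -
    have "F m - F (Suc m) = (-1) ^ m *
        (poch_series (b + real m + a) a (b + real m) + poch_series (b + real m + a + 1) a (b + real m + 1))"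
      by (simp add: F_def distrib_left add_ac)
    also have "poch_series (b + real m + a) a (b + real m) + poch_series (b + real m + a + 1) a (b + real m + 1)
        = 1 / (b + real m - a) - 1 / (b + real m + a)"
      using assms by (intro poch_series_adjacent_shifts) auto
    finally show ?thesis by (simp add: add_ac diff_add_eq)
  qed
  ultimately show ?thesis by (simp add: F_def)
qed

section \<open>Expansion in zeta values\<close>

text \<open>
  Only even integers \<open>m + 1\<close> carry a minus sign. Removing them twice from \<open>\<zeta>(k)\<close> subtracts
  \<open>2 \<cdot> 2\<^bsup>-k\<^esup> \<zeta>(k)\<close>.
\<close>

lemma alternating_zeta_sums:
  assumes "2 \<le> k"
  shows "(\<lambda>m. (-1) ^ m / real (Suc m) ^ k) sums ((1 - 2 / 2 ^ k) * (\<Sum>m. 1 / real (Suc m) ^ k))"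
proof -
  define Z where "Z = (\<Sum>m. 1 / real (Suc m) ^ k)"
  have Z: "(\<lambda>m. 1 / real (Suc m) ^ k) sums Z"
    unfolding Z_def using summable_Suc_iff[THEN iffD2, OF inverse_power_summable[OF assms, where 'a = real]]
    by (intro summable_sums) (simp add: inverse_eq_divide)
  have "(\<lambda>j. 2 / 2 ^ k * (1 / real (Suc j) ^ k)) sums (2 / 2 ^ k * Z)"
    using Z by (rule sums_mult)
  then have "(\<lambda>m. if even m then 0 else 2 / 2 ^ k * (1 / real (Suc ((m - 1) div 2)) ^ k)) sums (2 / 2 ^ k * Z)"
    by (rule sums_if')
  then have "(\<lambda>m. 1 / real (Suc m) ^ k - (if even m then 0 else 2 / 2 ^ k * (1 / real (Suc ((m - 1) div 2)) ^ k)))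
     sums (Z - 2 / 2 ^ k * Z)"
    by (intro sums_diff Z)
  moreover have "1 / real (Suc m) ^ k - (if even m then 0 else 2 / 2 ^ k * (1 / real (Suc ((m - 1) div 2)) ^ k))
      = (-1) ^ m / real (Suc m) ^ k" for m
  proof (cases "even m")
    case False
    then obtain j where j: "m = 2 * j + 1" by (elim oddE)
    then have "real (Suc m) = 2 * real (Suc j)" by simp
    then have "real (Suc m) ^ k = 2 ^ k * real (Suc j) ^ k"
      by (simp only: power_mult_distrib)
    then show ?thesis using False j by simp
  qed simp
  ultimately show ?thesis by (simp add: Z_def algebra_simps)
qed

text \<open>
  Summation by parts: multiplication by \<open>z - x\<close> replaces the coefficients \<open>c + \<Sum>\<^bsub>j<r\<^esub> (N choose j)\<close> by
  their differences, which are binomial coefficients, and leaves two boundary terms.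
\<close>

lemma binomial_partial_sum_telescope:
  fixes x z c :: real
  shows "(z - x) * (\<Sum>r=1..N. x ^ (N + 1 - r) * z ^ r * (c + (\<Sum>j<r. real (N choose j))))
    = x * z * ((c + 2 ^ N) * z ^ N - c * x ^ N - (x + z) ^ N)"
proof -
  define B where "B r = c + (\<Sum>j<r. real (N choose j))" for r
  have B0: "B 0 = c" and BSuc: "B (Suc r) = B r + real (N choose r)" for r
    by (simp_all add: B_def)
  have BN: "B (Suc N) = c + 2 ^ N"
    using choose_row_sum[of N] by (simp add: B_def lessThan_Suc_atMost flip: of_nat_sum)
  have "(z - x) * (\<Sum>r=1..N. x ^ (N + 1 - r) * z ^ r * B r)
      = (\<Sum>r=1..N. x * z * (x ^ (N - r) * z ^ r * B r)) - (\<Sum>r=1..N. x * x * (x ^ (N - r) * z ^ r * B r))"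
    unfolding sum_distrib_left sum_subtractf[symmetric]
    by (intro sum.cong refl) (auto simp: Suc_diff_le algebra_simps)
  also have "(\<Sum>r=1..N. x * x * (x ^ (N - r) * z ^ r * B r))
      = (\<Sum>r<N. x * z * (x ^ (N - r) * z ^ r * B (Suc r)))"
  proof -
    have "x ^ (N - r) = x * x ^ (N - Suc r)" if "r < N" for r
      using that by (metis Suc_diff_Suc power_Suc)
    then show ?thesis
      unfolding One_nat_def sum.atLeast1_atMost_eq by (intro sum.cong refl) simp
  qed
  also have "(\<Sum>r=1..N. x * z * (x ^ (N - r) * z ^ r * B r))
      = (\<Sum>r\<le>N. x * z * (x ^ (N - r) * z ^ r * B r)) - x * z * x ^ N * B 0"
    by (simp add: atMost_atLeast0 sum.atLeast_Suc_atMost[of 0 N])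
  also have "(\<Sum>r<N. x * z * (x ^ (N - r) * z ^ r * B (Suc r)))
      = (\<Sum>r\<le>N. x * z * (x ^ (N - r) * z ^ r * B (Suc r))) - x * z * z ^ N * B (Suc N)"
    by (simp add: lessThan_Suc_atMost[symmetric])
  also have "(\<Sum>r\<le>N. x * z * (x ^ (N - r) * z ^ r * B r)) - x * z * x ^ N * B 0
     - ((\<Sum>r\<le>N. x * z * (x ^ (N - r) * z ^ r * B (Suc r))) - x * z * z ^ N * B (Suc N))
     = x * z * (z ^ N * B (Suc N) - x ^ N * B 0 - (\<Sum>r\<le>N. real (N choose r) * z ^ r * x ^ (N - r)))"
    unfolding BSuc by (simp add: sum_subtractf sum.distrib sum_distrib_left algebra_simps)
  also have "(\<Sum>r\<le>N. real (N choose r) * z ^ r * x ^ (N - r)) = (x + z) ^ N"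
    using binomial_ring[of z x N] by (simp add: add.commute)
  finally show ?thesis unfolding B0 BN by (simp add: B_def algebra_simps)
qed

text \<open>
  The geometric expansion starts at the second term. The first terms \<open>1/n\<close> of the fractions to be
  expanded are not summable over \<open>n\<close> individually; they cancel in the combination used below.
\<close>

lemma geometric_tail_sums:
  fixes n c :: real
  assumes "\<bar>c\<bar> < n"
  shows "(\<lambda>k. c ^ (k + 1) / n ^ (k + 2)) sums (1 / (n - c) - 1 / n)"
proof -
  have n: "n > 0" "n - c > 0" using assms by linarith+
  have "(\<lambda>k. c / n ^ 2 * (c / n) ^ k) sums (c / n ^ 2 * (1 / (1 - c / n)))"
    using assms n by (intro sums_mult geometric_sums) simp
  moreover have "c / n ^ 2 * (1 / (1 - c / n)) = 1 / (n - c) - 1 / n"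
    using n by (simp add: field_simps power2_eq_square)
  ultimately show ?thesis
    using n by (simp add: power_divide power2_eq_square mult_ac)
qed

lemma has_sum_if_sums:
  fixes f :: "nat \<Rightarrow> real"
  assumes "f summable_on UNIV" "f sums a"
  shows "(f has_sum a) UNIV"
  using has_sum_infsum[OF assms(1)] sums_unique2[OF has_sum_imp_sums assms(2)] by blast

text \<open>
  Both series are evaluated as sums over \<open>m\<close> of fractions \<open>1 / (m + 1 - c)\<close> with
  \<open>c \<in> {2 x, 2 z, x + z}\<close>. Expanding each fraction in powers of \<open>c / (m + 1)\<close> and summing over \<open>m\<close>
  first gives zeta values; for \<open>c = 2 x\<close> and \<open>c = 2 z\<close> the signs \<open>(-1)\<^sup>m\<close> enter.
\<close>

lemma poch_series_zeta_expansion: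
  assumes xz: "0 < x" "x < z" "z < 1 / 2"
  shows "(\<lambda>k. (2 * (2 * z) ^ (k + 1) - z ^ (k + 1) - (2 ^ (k + 1) - 1) * x ^ (k + 1) - (x + z) ^ (k + 1))
              * (\<Sum>m. 1 / real (Suc m) ^ (k + 2)))
       sums (poch_series 1 (z - x) (1 - x - z) + poch_series (1 - 2 * x) (z - x) (1 - x - z))"
proof -
  define f where "f m k = (((1 + (-1) ^ m) * (2 * z) ^ (k + 1) - (-1) ^ m * (2 * x) ^ (k + 1) - (x + z) ^ (k + 1)))
              / real (Suc m) ^ (k + 2)" for m k :: nat
  define g where "g m = (1 + (-1) ^ m) / (real (Suc m) - 2 * z) - (-1) ^ m / (real (Suc m) - 2 * x)
    - 1 / (real (Suc m) - (x + z))" for m :: nat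
  define h where "h k = (2 * (2 * z) ^ (k + 1) - z ^ (k + 1) - (2 ^ (k + 1) - 1) * x ^ (k + 1) - (x + z) ^ (k + 1))
              * (\<Sum>m. 1 / real (Suc m) ^ (k + 2))" for k :: nat
  have "(\<lambda>m. (1 / (1 - x - z - (z - x) + real m) - 1 / (1 - x - z + real m))
     + (-1) ^ m * (1 / (1 - x - z - (z - x) + real m) - 1 / (1 - x - z + (z - x) + real m)))
     sums (poch_series 1 (z - x) (1 - x - z) + poch_series (1 - x - z + (z - x)) (z - x) (1 - x - z))"
    using xz by (intro sums_add poch_series_nonalternating poch_series_alternating) auto
  also have "(\<lambda>m. (1 / (1 - x - z - (z - x) + real m) - 1 / (1 - x - z + real m))
     + (-1) ^ m * (1 / (1 - x - z - (z - x) + real m) - 1 / (1 - x - z + (z - x) + real m))) = g"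
  proof
    fix m
    have "1 - x - z - (z - x) + real m = real (Suc m) - 2 * z" "1 - x - z + real m = real (Suc m) - (x + z)"
      "1 - x - z + (z - x) + real m = real (Suc m) - 2 * x" by auto
    then show "1 / (1 - x - z - (z - x) + real m) - 1 / (1 - x - z + real m)
     + (-1) ^ m * (1 / (1 - x - z - (z - x) + real m) - 1 / (1 - x - z + (z - x) + real m)) = g m"
      by (simp only: g_def) (simp add: add_divide_distrib right_diff_distrib)
  qed
  also have "1 - x - z + (z - x) = 1 - 2 * x" by simp
  finally have g: "g sums (poch_series 1 (z - x) (1 - x - z) + poch_series (1 - 2 * x) (z - x) (1 - x - z))" .
  have row: "f m sums g m" for m
  proof -
    have "(\<lambda>k. (1 + (-1) ^ m) * ((2 * z) ^ (k + 1) / real (Suc m) ^ (k + 2))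
       - (-1) ^ m * ((2 * x) ^ (k + 1) / real (Suc m) ^ (k + 2)) - (x + z) ^ (k + 1) / real (Suc m) ^ (k + 2))
      sums ((1 + (-1) ^ m) * (1 / (real (Suc m) - 2 * z) - 1 / real (Suc m))
        - (-1) ^ m * (1 / (real (Suc m) - 2 * x) - 1 / real (Suc m))
        - (1 / (real (Suc m) - (x + z)) - 1 / real (Suc m)))"
      using xz by (intro sums_diff sums_mult geometric_tail_sums) auto
    also have "(\<lambda>k. (1 + (-1) ^ m) * ((2 * z) ^ (k + 1) / real (Suc m) ^ (k + 2))
       - (-1) ^ m * ((2 * x) ^ (k + 1) / real (Suc m) ^ (k + 2)) - (x + z) ^ (k + 1) / real (Suc m) ^ (k + 2)) = f m"
      by (simp add: f_def diff_divide_distrib fun_eq_iff)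
    also have "(1 + (-1) ^ m) * (1 / (real (Suc m) - 2 * z) - 1 / real (Suc m))
        - (-1) ^ m * (1 / (real (Suc m) - 2 * x) - 1 / real (Suc m))
        - (1 / (real (Suc m) - (x + z)) - 1 / real (Suc m)) = g m"
      by (simp add: g_def algebra_simps add_divide_distrib)
    finally show ?thesis .
  qed
  have col: "(\<lambda>m. f m k) sums h k" for k
  proof -
    define Z where "Z = (\<Sum>m. 1 / real (Suc m) ^ (k + 2))"
    have Z: "(\<lambda>m. 1 / real (Suc m) ^ (k + 2)) sums Z"
      unfolding Z_def using summable_Suc_iff[THEN iffD2, OF inverse_power_summable[of "k + 2", where 'a = real]]
      by (intro summable_sums) (simp add: inverse_eq_divide)
    have A: "(\<lambda>m. (-1) ^ m / real (Suc m) ^ (k + 2)) sums ((1 - 2 / 2 ^ (k + 2)) * Z)"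
      unfolding Z_def by (rule alternating_zeta_sums) simp
    have "(\<lambda>m. (2 * z) ^ (k + 1) * (1 / real (Suc m) ^ (k + 2) + (-1) ^ m / real (Suc m) ^ (k + 2))
       - (2 * x) ^ (k + 1) * ((-1) ^ m / real (Suc m) ^ (k + 2)) - (x + z) ^ (k + 1) * (1 / real (Suc m) ^ (k + 2)))
      sums ((2 * z) ^ (k + 1) * (Z + (1 - 2 / 2 ^ (k + 2)) * Z)
        - (2 * x) ^ (k + 1) * ((1 - 2 / 2 ^ (k + 2)) * Z) - (x + z) ^ (k + 1) * Z)"
      by (intro sums_diff sums_mult sums_add Z A)
    also have "(\<lambda>m. (2 * z) ^ (k + 1) * (1 / real (Suc m) ^ (k + 2) + (-1) ^ m / real (Suc m) ^ (k + 2))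
       - (2 * x) ^ (k + 1) * ((-1) ^ m / real (Suc m) ^ (k + 2)) - (x + z) ^ (k + 1) * (1 / real (Suc m) ^ (k + 2)))
      = (\<lambda>m. f m k)"
      by (simp add: f_def diff_divide_distrib add_divide_distrib fun_eq_iff algebra_simps)
    also have "(2 * z) ^ (k + 1) * (Z + (1 - 2 / 2 ^ (k + 2)) * Z)
        - (2 * x) ^ (k + 1) * ((1 - 2 / 2 ^ (k + 2)) * Z) - (x + z) ^ (k + 1) * Z = h k"
    proof -
      have hk: "h k = (2 * (2 * z) ^ (k + 1) - z ^ (k + 1) - (2 ^ (k + 1) - 1) * x ^ (k + 1) - (x + z) ^ (k + 1)) * Z"
        by (simp only: h_def Z_def)
      show ?thesis unfolding hk by (simp add: power_mult_distrib field_simps)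
    qed
    finally show ?thesis .
  qed
  \<comment> \<open>A summable majorant that justifies the interchange: all of \<open>2 x\<close>, \<open>x + z\<close> are at most \<open>2 z < 1\<close>, and
    the exponent of \<open>m + 1\<close> is at least \<open>2\<close>.\<close>
  define F where "F m k = 4 * (2 * z) ^ (k + 1) * (1 / real (Suc m) ^ 2)" for m k :: nat
  have bound: "\<bar>f m k\<bar> \<le> F m k" for m k
  proof -
    have "\<bar>((1 + (-1) ^ m) * (2 * z) ^ (k + 1) - (-1) ^ m * (2 * x) ^ (k + 1) - (x + z) ^ (k + 1))\<bar>
      \<le> \<bar>(1 + (-1) ^ m) * (2 * z) ^ (k + 1)\<bar> + \<bar>(-1) ^ m * (2 * x) ^ (k + 1)\<bar> + \<bar>(x + z) ^ (k + 1)\<bar>"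
      by linarith
    also have "\<dots> \<le> 2 * (2 * z) ^ (k + 1) + (2 * x) ^ (k + 1) + (x + z) ^ (k + 1)"
      using xz by (intro add_mono) (auto simp: abs_mult minus_one_power_iff)
    also have "\<dots> \<le> 2 * (2 * z) ^ (k + 1) + (2 * z) ^ (k + 1) + (2 * z) ^ (k + 1)"
      using xz by (intro add_mono power_mono) auto
    also have "\<dots> = 4 * (2 * z) ^ (k + 1)"
      by (simp del: power_Suc)
    finally have 1: "\<bar>((1 + (-1) ^ m) * (2 * z) ^ (k + 1) - (-1) ^ m * (2 * x) ^ (k + 1) - (x + z) ^ (k + 1))\<bar>
      \<le> 4 * (2 * z) ^ (k + 1)" .
    have "real (Suc m) ^ 2 \<le> real (Suc m) ^ (k + 2)"
      by (intro power_increasing) auto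
    with 1 have "\<bar>((1 + (-1) ^ m) * (2 * z) ^ (k + 1) - (-1) ^ m * (2 * x) ^ (k + 1) - (x + z) ^ (k + 1))\<bar> / real (Suc m) ^ (k + 2)
      \<le> 4 * (2 * z) ^ (k + 1) / real (Suc m) ^ 2"
      by (intro frac_le) auto
    then show ?thesis by (simp add: f_def F_def abs_divide del: of_nat_Suc power_Suc)
  qed
  have "summable (\<lambda>m. 1 / real (Suc m) ^ 2)"
    using summable_Suc_iff[THEN iffD2, OF inverse_power_summable[of 2, where 'a = real]]
    by (simp add: inverse_eq_divide)
  moreover have "summable (\<lambda>k. 4 * (2 * z) ^ (k + 1))"
    using xz by (intro summable_mult summable_ignore_initial_segment summable_geometric) auto
  ultimately have sq: "(\<lambda>m. 1 / real (Suc m) ^ 2) summable_on UNIV"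
    and geo: "(\<lambda>k. 4 * (2 * z) ^ (k + 1)) summable_on UNIV"
    using xz by (auto intro!: summable_nonneg_imp_summable_on simp del: power_Suc)
  have "(\<lambda>(m, k). F m k) summable_on UNIV \<times> UNIV"
  proof (rule summable_on_SigmaI)
    show "((\<lambda>k. (\<lambda>(m, k). F m k) (m, k)) has_sum (\<Sum>\<^sub>\<infinity>k. 4 * (2 * z) ^ (k + 1)) * (1 / real (Suc m) ^ 2)) UNIV" for m
      unfolding F_def prod.case by (intro has_sum_cmult_left has_sum_infsum geo)
    show "(\<lambda>m. (\<Sum>\<^sub>\<infinity>k. 4 * (2 * z) ^ (k + 1)) * (1 / real (Suc m) ^ 2)) summable_on UNIV"
      by (intro summable_on_cmult_right sq)
  qed (use xz in \<open>simp add: F_def\<close>)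
  then have "(\<lambda>p. \<bar>case p of (m, k) \<Rightarrow> f m k\<bar>) summable_on UNIV \<times> UNIV"
    by (rule summable_on_comparison_test) (auto simp: bound)
  then have fs: "(\<lambda>(m, k). f m k) summable_on UNIV \<times> UNIV"
    unfolding summable_on_iff_abs_summable_on_real[of "\<lambda>(m, k). f m k"] by simp
  define S where "S = (\<Sum>\<^sub>\<infinity>(m, k)\<in>UNIV \<times> UNIV. f m k)"
  have S: "((\<lambda>(m, k). f m k) has_sum S) (UNIV \<times> UNIV)"
    unfolding S_def using fs by (rule has_sum_infsum)
  have rowS: "(f m has_sum g m) UNIV" for m
  proof -
    have "(f m) summable_on UNIV"
      using summable_on_SigmaD1[of f UNIV "\<lambda>_. UNIV" m] fs by simp
    then show ?thesis
      using row[of m] by (rule has_sum_if_sums)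
  qed
  have "(g has_sum S) UNIV"
    using has_sum_SigmaD[OF S, of g] rowS by auto
  then have "g sums S" by (rule has_sum_imp_sums)
  have S': "((\<lambda>(k, m). f m k) has_sum S) (UNIV \<times> UNIV)"
    using has_sum_swap[THEN iffD1, OF S] by simp
  have colS: "((\<lambda>m. f m k) has_sum h k) UNIV" for k
  proof -
    have "(\<lambda>m. f m k) summable_on UNIV"
      using summable_on_SigmaD1[of "\<lambda>k m. f m k" UNIV "\<lambda>_. UNIV" k] has_sum_imp_summable[OF S'] by simp
    then show ?thesis
      using col[of k] by (rule has_sum_if_sums)
  qed
  have "(h has_sum S) UNIV"
    using has_sum_SigmaD[OF S', of h] colS by auto
  then have "h sums S" by (rule has_sum_imp_sums)
  with \<open>g sums S\<close> g have "h sums (poch_series 1 (z - x) (1 - x - z) + poch_series (1 - 2 * x) (z - x) (1 - x - z))"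
    using sums_unique2[of g S] by metis
  then show ?thesis by (simp only: h_def[abs_def])
qed

section \<open>Interpolated values as sums over weakly increasing tuples\<close>

definition strict_tuples :: "nat \<Rightarrow> nat \<Rightarrow> nat list set" where
  "strict_tuples m r = {ns. length ns = r \<and> sorted_wrt (<) ns \<and> (\<forall>n\<in>set ns. m < n)}"

text \<open>
  The series \<open>\<zeta>(ks)\<close> restricted to tuples with all entries above \<open>m\<close>. Keeping \<open>m\<close> free allows
  recursion on the first entry.
\<close>

definition tail_mzv :: "nat list \<Rightarrow> nat \<Rightarrow> ennreal" where
  "tail_mzv ks m = (\<Sum>\<^sub>\<infinity>ns\<in>strict_tuples m (length ks).
     ennreal (1 / (\<Prod>i<length ks. real (ns ! i) ^ (ks ! i))))"

lemma tail_mzv_Nil: "tail_mzv [] m = 1"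
proof -
  have "strict_tuples m 0 = {[]}" by (auto simp: strict_tuples_def)
  then show ?thesis by (simp add: tail_mzv_def)
qed

lemma ennreal_one_over_mult:
  "0 \<le> a \<Longrightarrow> ennreal (1 / a) * ennreal (1 / b) = ennreal (1 / (a * b))"
  using ennreal_mult'[of "1 / a" "1 / b"] by simp

lemma tail_mzv_Cons:
  "tail_mzv (k # ks) m = (\<Sum>\<^sub>\<infinity>n\<in>{m<..}. ennreal (1 / real n ^ k) * tail_mzv ks n)"
proof -
  have "tail_mzv (k # ks) m
      = (\<Sum>\<^sub>\<infinity>(n, ns)\<in>(SIGMA n:{m<..}. strict_tuples n (length ks)).
           ennreal (1 / real n ^ k) * ennreal (1 / (\<Prod>i<length ks. real (ns ! i) ^ (ks ! i))))"
    unfolding tail_mzv_def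
    by (rule infsum_reindex_bij_witness[of _ "\<lambda>(n, ns). n # ns" "\<lambda>ns. (hd ns, tl ns)"])
       (auto simp: strict_tuples_def length_Suc_conv prod.lessThan_Suc_shift ennreal_one_over_mult
             simp del: prod.lessThan_Suc intro: less_trans)
  also have "\<dots> = (\<Sum>\<^sub>\<infinity>n\<in>{m<..}. ennreal (1 / real n ^ k) * tail_mzv ks n)"
    unfolding infsum_ennreal_Sigma[symmetric] tail_mzv_def by (simp add: infsum_ennreal_cmult)
  finally show ?thesis .
qed

lemma ennreal_mzv:
  assumes "tail_mzv ks 0 \<noteq> top"
  shows "ennreal (mzv ks) = tail_mzv ks 0"
  using assms unfolding mzv_def tail_mzv_def strict_tuples_def
  by (intro ennreal_infsum) (auto intro!: prod_nonneg)

definition interp_tail :: "real \<Rightarrow> nat list \<Rightarrow> nat \<Rightarrow> ennreal" where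
  "interp_tail t ks m = (\<Sum>bs\<in>{bs :: box list. length bs = length ks - 1}.
     tail_mzv (fill ks bs) m * ennreal (t ^ (length ks - length (fill ks bs))))"

lemma length_fill_le: "length (fill ks bs) \<le> length ks"
  by (induction ks bs rule: fill.induct) auto

text \<open>
  Sums over tuples \<open>m \<le> n\<^sub>1 \<le> n\<^sub>2 \<le> \<dots>\<close> in which each equality of neighbours, including \<open>m = n\<^sub>1\<close>,
  contributes a factor \<open>t\<close>.
\<close>

fun weak_tail :: "real \<Rightarrow> nat list \<Rightarrow> nat \<Rightarrow> ennreal" where
  "weak_tail t [] m = 1"
| "weak_tail t (k # ks) m = (\<Sum>\<^sub>\<infinity>n\<in>{m<..}. ennreal (1 / real n ^ k) * weak_tail t ks n)
     + ennreal t * ennreal (1 / real m ^ k) * weak_tail t ks m"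

lemma boxes_Suc: "{bs :: box list. length bs = Suc n}
    = (#) Comma ` {bs. length bs = n} \<union> (#) Plus ` {bs. length bs = n}"
proof -
  have "b = Comma \<or> b = Plus" for b by (cases b) auto
  then show ?thesis by (auto simp: length_Suc_conv)
qed

text \<open>
  Either the first box is a comma, and the smallest summation variable splits off, or it is a plus,
  and the first two entries merge at the cost of one factor \<open>t\<close>.
\<close>

lemma interp_tail_rec:
  assumes "0 \<le> t"
  shows "interp_tail t (k # k' # ks) m
     = (\<Sum>\<^sub>\<infinity>n\<in>{m<..}. ennreal (1 / real n ^ k) * interp_tail t (k' # ks) n)
       + ennreal t * interp_tail t ((k + k') # ks) m"
proof -
  define L where "L = {bs :: box list. length bs = length ks}"
  have L: "{bs :: box list. length bs = Suc (length ks)} = (#) Comma ` L \<union> (#) Plus ` L" "finite L"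
    by (simp_all add: L_def boxes_Suc card_fillings)
  have le: "length (fill ((k + k') # ks) bs) \<le> Suc (length ks)" for bs
    using length_fill_le[of "(k + k') # ks" bs] by simp
  have "interp_tail t (k # k' # ks) m
      = (\<Sum>bs\<in>L. tail_mzv (k # fill (k' # ks) bs) m * ennreal (t ^ (Suc (length ks) - length (fill (k' # ks) bs))))
      + (\<Sum>bs\<in>L. tail_mzv (fill ((k + k') # ks) bs) m * ennreal (t ^ (Suc (Suc (length ks)) - length (fill ((k + k') # ks) bs))))"
  proof -
    have "(#) Comma ` L \<inter> (#) Plus ` L = {}" by auto
    then show ?thesis
      unfolding interp_tail_def using L(2) by (simp add: L(1) sum.union_disjoint sum.reindex)
  qed
  also have "(\<Sum>bs\<in>L. tail_mzv (k # fill (k' # ks) bs) m * ennreal (t ^ (Suc (length ks) - length (fill (k' # ks) bs))))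
     = (\<Sum>\<^sub>\<infinity>n\<in>{m<..}. ennreal (1 / real n ^ k) * interp_tail t (k' # ks) n)"
    unfolding tail_mzv_Cons infsum_ennreal_multc[symmetric] infsum_ennreal_sum[OF L(2), symmetric]
    by (simp add: interp_tail_def L_def[symmetric] sum_distrib_left mult_ac)
  also have "(\<Sum>bs\<in>L. tail_mzv (fill ((k + k') # ks) bs) m * ennreal (t ^ (Suc (Suc (length ks)) - length (fill ((k + k') # ks) bs))))
    = ennreal t * interp_tail t ((k + k') # ks) m"
    using le assms by (simp add: interp_tail_def L_def[symmetric] sum_distrib_left Suc_diff_le ennreal_mult mult_ac)
  finally show ?thesis .
qed

text \<open>
  A plus between two entries is the same as letting their summation variables coincide.
\<close>

lemma interp_tail_eq_weak_tail:
  assumes "0 \<le> t"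
  shows "interp_tail t (k # ks) m = (\<Sum>\<^sub>\<infinity>n\<in>{m<..}. ennreal (1 / real n ^ k) * weak_tail t ks n)"
proof (induction ks arbitrary: k m)
  case Nil
  show ?case by (simp add: interp_tail_def tail_mzv_Cons tail_mzv_Nil)
next
  case (Cons k' ks)
  have "interp_tail t (k # k' # ks) m
     = (\<Sum>\<^sub>\<infinity>n\<in>{m<..}. ennreal (1 / real n ^ k) * (\<Sum>\<^sub>\<infinity>n'\<in>{n<..}. ennreal (1 / real n' ^ k') * weak_tail t ks n'))
      + ennreal t * (\<Sum>\<^sub>\<infinity>n\<in>{m<..}. ennreal (1 / real n ^ (k + k')) * weak_tail t ks n)"
    by (simp only: interp_tail_rec[OF assms] Cons.IH)
  also have "ennreal t * (\<Sum>\<^sub>\<infinity>n\<in>{m<..}. ennreal (1 / real n ^ (k + k')) * weak_tail t ks n)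
     = (\<Sum>\<^sub>\<infinity>n\<in>{m<..}. ennreal (1 / real n ^ k) * (ennreal t * ennreal (1 / real n ^ k') * weak_tail t ks n))"
  proof -
    have "ennreal (1 / real n ^ (k + k')) = ennreal (1 / real n ^ k) * ennreal (1 / real n ^ k')" for n
      by (simp add: power_add flip: ennreal_mult)
    then show ?thesis unfolding infsum_ennreal_cmult[symmetric] by (simp add: mult_ac)
  qed
  finally show ?case
    by (simp add: infsum_ennreal_add[symmetric] distrib_left)
qed

text \<open>
  The mirror image of \<open>weak_tail\<close>: sums over tuples bounded above by \<open>n\<close>, with the list read from the
  largest variable downwards. In contrast to \<open>weak_tail\<close> they range over finite sets.
\<close>

fun weak_head :: "real \<Rightarrow> nat list \<Rightarrow> nat \<Rightarrow> ennreal" where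
  "weak_head t [] n = 1"
| "weak_head t (k # ks) n = (\<Sum>m\<in>{0<..<n}. ennreal (1 / real m ^ k) * weak_head t ks m)
     + ennreal t * ennreal (1 / real n ^ k) * weak_head t ks n"

text \<open>
  The expression is a sum over pairs \<open>n \<le> m\<close>, where \<open>n = m\<close> is weighted by \<open>t\<close>. It can be organised
  by \<open>n\<close> or by \<open>m\<close>, so an entry moves from the tail to the head.
\<close>

lemma weak_head_tail_transfer:
  "(\<Sum>\<^sub>\<infinity>n\<in>{0<..}. ennreal (1 / real n ^ k) * weak_head t hs n * weak_tail t (l # ls) n)
   = (\<Sum>\<^sub>\<infinity>n\<in>{0<..}. ennreal (1 / real n ^ l) * weak_head t (k # hs) n * weak_tail t ls n)"
proof -
  define P where "P n = ennreal (1 / real n ^ k) * weak_head t hs n" for n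
  define W where "W n = ennreal (1 / real n ^ l) * weak_tail t ls n" for n
  have "(\<Sum>\<^sub>\<infinity>n\<in>{0<..}. P n * (\<Sum>\<^sub>\<infinity>m\<in>{n<..}. W m)) = (\<Sum>\<^sub>\<infinity>(n, m)\<in>(SIGMA n:{0<..}. {n<..}). P n * W m)"
    by (simp add: infsum_ennreal_cmult[symmetric] infsum_ennreal_Sigma)
  also have "\<dots> = (\<Sum>\<^sub>\<infinity>(m, n)\<in>(SIGMA m:{0<..}. {0<..<m}). P n * W m)"
    by (rule infsum_reindex_bij_witness[of _ "\<lambda>(m, n). (n, m)" "\<lambda>(n, m). (m, n)"]) auto
  also have "\<dots> = (\<Sum>\<^sub>\<infinity>m\<in>{0<..}. (\<Sum>n\<in>{0<..<m}. P n) * W m)"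
    by (simp add: infsum_ennreal_Sigma[symmetric] sum_distrib_right)
  finally have 1: "(\<Sum>\<^sub>\<infinity>n\<in>{0<..}. P n * (\<Sum>\<^sub>\<infinity>m\<in>{n<..}. W m)) = (\<Sum>\<^sub>\<infinity>m\<in>{0<..}. (\<Sum>n\<in>{0<..<m}. P n) * W m)" .
  have "(\<Sum>\<^sub>\<infinity>n\<in>{0<..}. ennreal (1 / real n ^ k) * weak_head t hs n * weak_tail t (l # ls) n)
    = (\<Sum>\<^sub>\<infinity>n\<in>{0<..}. P n * (\<Sum>\<^sub>\<infinity>m\<in>{n<..}. W m)) + (\<Sum>\<^sub>\<infinity>n\<in>{0<..}. P n * (ennreal t * W n))"
    by (simp add: P_def W_def infsum_ennreal_add[symmetric] distrib_left mult.assoc)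
  also have "\<dots> = (\<Sum>\<^sub>\<infinity>n\<in>{0<..}. ennreal (1 / real n ^ l) * weak_head t (k # hs) n * weak_tail t ls n)"
    unfolding 1 by (simp add: P_def W_def infsum_ennreal_add[symmetric] distrib_left distrib_right mult_ac)
  finally show ?thesis .
qed

lemma weak_head_tail_sum:
  "(\<Sum>\<^sub>\<infinity>n\<in>{0<..}. ennreal (1 / real n ^ k) * weak_head t hs n * weak_tail t (ls @ [l]) n)
   = (\<Sum>\<^sub>\<infinity>n\<in>{0<..}. ennreal (1 / real n ^ l) * weak_head t (rev ls @ k # hs) n)"
proof (induction ls arbitrary: k hs)
  case Nil
  show ?case using weak_head_tail_transfer[of k t hs l "[]"] by simp
next
  case (Cons l' ls)
  show ?case
    using weak_head_tail_transfer[of k t hs l' "ls @ [l]"] Cons.IH[of l' "k # hs"] by simp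
qed

text \<open>
  Moving all entries but the last to the head reorganises the series by its largest variable. The
  last entry, which has its own weight in the theorem, is thereby isolated.
\<close>

lemma interp_tail_snoc:
  assumes "0 \<le> t"
  shows "interp_tail t (ks @ [l]) 0 = (\<Sum>\<^sub>\<infinity>n\<in>{0<..}. ennreal (1 / real n ^ l) * weak_head t (rev ks) n)"
proof (cases ks)
  case Nil
  then show ?thesis using interp_tail_eq_weak_tail[OF assms, of l "[]" 0] by simp
next
  case (Cons k ks')
  then show ?thesis
    using interp_tail_eq_weak_tail[OF assms, of k "ks' @ [l]" 0] weak_head_tail_sum[of k t "[]" ks' l]
    by simp
qed

text \<open>
  If the extended sum is finite then so is each of its \<open>2\<^bsup>r-1\<^esup>\<close> summands, because \<open>t\<close> is positive.
\<close>

lemma ennreal_interpolated_mzv: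
  assumes "0 < t" "interp_tail t ks 0 \<noteq> top"
  shows "ennreal (interpolated_mzv t ks) = interp_tail t ks 0" "0 \<le> interpolated_mzv t ks"
proof -
  define L where "L = {bs :: box list. length bs = length ks - 1}"
  have "finite L" by (simp add: L_def card_fillings)
  have nonneg: "0 \<le> mzv ks" for ks
    unfolding mzv_def by (intro infsum_nonneg divide_nonneg_nonneg prod_nonneg) auto
  have fin: "tail_mzv (fill ks bs) 0 \<noteq> top" if "bs \<in> L" for bs
  proof
    assume *: "tail_mzv (fill ks bs) 0 = top"
    have "tail_mzv (fill ks bs) 0 * ennreal (t ^ (length ks - length (fill ks bs))) \<le> interp_tail t ks 0"
      unfolding interp_tail_def L_def[symmetric] using that \<open>finite L\<close> by (intro member_le_sum) auto
    with * assms show False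
      by (simp add: ennreal_top_mult top_unique)
  qed
  have "ennreal (interpolated_mzv t ks)
     = (\<Sum>bs\<in>L. ennreal (mzv (fill ks bs) * t ^ (length ks - length (fill ks bs))))"
    unfolding interpolated_mzv_def L_def[symmetric] using assms nonneg
    by (intro sum_ennreal[symmetric]) auto
  also have "\<dots> = interp_tail t ks 0"
    unfolding interp_tail_def L_def[symmetric] using assms fin nonneg
    by (intro sum.cong refl) (simp add: ennreal_mult ennreal_mzv)
  finally show "ennreal (interpolated_mzv t ks) = interp_tail t ks 0" .
  show "0 \<le> interpolated_mzv t ks"
    unfolding interpolated_mzv_def using assms nonneg by (intro sum_nonneg mult_nonneg_nonneg) auto
qed

section \<open>Generating functions over indices\<close>

text \<open>
  Summing the recursion over \<open>j\<close> gives a linear equation for the sum; the same inequality for partial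
  sums bounds them and so proves convergence.
\<close>

lemma affine_recursion_sums:
  fixes a b :: "nat \<Rightarrow> real"
  assumes a: "\<And>j. a (Suc j) = b j + q * a j" and b: "b sums B" "\<And>j. 0 \<le> b j"
    and q: "0 \<le> q" "q < 1" and a0: "0 \<le> a 0"
  shows "a sums ((a 0 + B) / (1 - q))"
proof -
  have nonneg: "0 \<le> a j" for j
    by (induction j) (auto simp: a a0 b(2) q)
  have "sum a {..<J} \<le> (a 0 + B) / (1 - q)" for J
  proof (induction J)
    case 0
    have "0 \<le> B" using b by (metis sums_unique suminf_nonneg sums_summable)
    then show ?case using a0 q by simp
  next
    case (Suc J)
    have "sum a {..<Suc J} = a 0 + (sum b {..<J} + q * sum a {..<J})"
      by (simp add: sum.lessThan_Suc_shift a sum.distrib sum_distrib_left del: sum.lessThan_Suc)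
    also have "sum b {..<J} \<le> B"
      using b by (metis finite_lessThan sum_le_suminf sums_iff)
    also have "q * sum a {..<J} \<le> q * ((a 0 + B) / (1 - q))"
      using Suc q by (intro mult_left_mono)
    also have "a 0 + (B + q * ((a 0 + B) / (1 - q))) = (a 0 + B) / (1 - q)"
      using q by (simp add: field_simps)
    finally show ?case by simp
  qed
  then have "summable a"
    using nonneg by (intro bounded_imp_summable[of a "(a 0 + B) / (1 - q)"])
      (auto simp: lessThan_Suc_atMost[symmetric] simp del: sum.lessThan_Suc)
  then have sa: "a sums suminf a" by (rule summable_sums)
  then have "(\<lambda>j. a (Suc j)) sums (suminf a - a 0)"
    by (subst sums_Suc_iff) simp
  moreover have "(\<lambda>j. a (Suc j)) sums (B + q * suminf a)"
    unfolding a using sa b by (intro sums_add sums_mult)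
  ultimately have "suminf a - a 0 = B + q * suminf a"
    by (rule sums_unique2)
  then have "suminf a = (a 0 + B) / (1 - q)"
    using q by (simp add: field_simps)
  with sa show ?thesis by simp
qed

text \<open>
  The recursion of \<open>weak_head\<close>, summed over all lists of length \<open>j\<close> with weight \<open>y\<^sup>j x\<^bsup>wt - j\<^esup>\<close>: the sum over
  an entry \<open>k\<close> of \<open>y x\<^bsup>k-1\<^esup> / m\<^sup>k\<close> is \<open>U m = y / (m - x)\<close>.
\<close>

fun head_gf :: "(nat \<Rightarrow> real) \<Rightarrow> real \<Rightarrow> nat \<Rightarrow> nat \<Rightarrow> real" where
  "head_gf U t 0 n = 1"
| "head_gf U t (Suc j) n = (\<Sum>m\<in>{0<..<n}. U m * head_gf U t j m) + t * U n * head_gf U t j n"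

lemma head_gf_nonneg:
  assumes "0 \<le> t" "\<And>m. 0 < m \<Longrightarrow> 0 \<le> U m" "0 < n"
  shows "0 \<le> head_gf U t j n"
  using assms(3) by (induction j arbitrary: n) (auto intro!: add_nonneg_nonneg sum_nonneg mult_nonneg_nonneg assms)

lemma sum_times_prod_telescope:
  fixes c :: "nat \<Rightarrow> real"
  shows "1 + (\<Sum>m\<in>{0<..<Suc n}. c m * (\<Prod>i\<in>{0<..<m}. 1 + c i)) = (\<Prod>m\<in>{0<..<Suc n}. 1 + c m)"
proof (induction n)
  case 0
  have "{0<..<Suc 0} = {}" by auto
  then show ?case by simp
next
  case (Suc n)
  have "{0<..<Suc (Suc n)} = insert (Suc n) {0<..<Suc n}" by auto
  then show ?case using Suc by (simp add: algebra_simps)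
qed

text \<open>
  Each \<open>m < n\<close> occurs \<open>i \<ge> 0\<close> times in a tuple; \<open>i > 0\<close> occurrences contribute \<open>U\<^sub>m\<^sup>i t\<^bsup>i-1\<^esup>\<close>, and the
  total is \<open>1 + U\<^sub>m / (1 - t U\<^sub>m)\<close>. Each occurrence of \<open>n\<close> itself contributes \<open>t U\<^sub>n\<close>.
\<close>

lemma head_gf_sums:
  assumes t: "0 \<le> t" and U: "\<And>m. 0 < m \<Longrightarrow> 0 \<le> U m" "\<And>m. 0 < m \<Longrightarrow> t * U m < 1" and n: "0 < n"
  shows "(\<lambda>j. head_gf U t j n) sums ((\<Prod>m\<in>{0<..<n}. 1 + U m / (1 - t * U m)) / (1 - t * U n))"
  using n
proof (induction n rule: less_induct)
  case (less n)
  define c where "c m = U m / (1 - t * U m)" for m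
  have "(\<lambda>j. head_gf U t j n) sums ((head_gf U t 0 n + (\<Sum>m\<in>{0<..<n}. U m * ((\<Prod>i\<in>{0<..<m}. 1 + c i) / (1 - t * U m)))) / (1 - t * U n))"
  proof (rule affine_recursion_sums)
    show "(\<lambda>j. \<Sum>m\<in>{0<..<n}. U m * head_gf U t j m) sums (\<Sum>m\<in>{0<..<n}. U m * ((\<Prod>i\<in>{0<..<m}. 1 + c i) / (1 - t * U m)))"
      unfolding c_def by (intro sums_sum sums_mult less.IH) auto
  qed (use t U less.prems in \<open>auto intro!: sum_nonneg mult_nonneg_nonneg head_gf_nonneg\<close>)
  moreover have "head_gf U t 0 n + (\<Sum>m\<in>{0<..<n}. U m * ((\<Prod>i\<in>{0<..<m}. 1 + c i) / (1 - t * U m)))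
     = (\<Prod>m\<in>{0<..<n}. 1 + c m)"
    using sum_times_prod_telescope[of c "n - 1"] less.prems by (simp add: c_def)
  ultimately show ?case by (simp add: c_def)
qed

definition index_weight :: "real \<Rightarrow> real \<Rightarrow> nat list \<Rightarrow> real" where
  "index_weight x y ks = (\<Prod>k\<leftarrow>ks. y * x ^ (k - 1))"

lemma index_weight_eq:
  "is_index ks \<Longrightarrow> index_weight x y ks = y ^ length ks * x ^ (wt ks - length ks)"
proof (induction ks)
  case (Cons k ks)
  have "length ks \<le> wt ks"
    using Cons.prems sum_list_mono[of ks "\<lambda>_. 1" "\<lambda>k. k"] by (simp add: is_index_def sum_list_triv Suc_le_eq)
  moreover have "0 < k" using Cons.prems by (simp add: is_index_def)
  ultimately have "k + wt ks - Suc (length ks) = (k - 1) + (wt ks - length ks)" by simp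
  note exponent = this
  have "index_weight x y (k # ks) = y * x ^ (k - 1) * (y ^ length ks * x ^ (wt ks - length ks))"
    using Cons by (simp add: index_weight_def is_index_def)
  also have "\<dots> = y ^ length (k # ks) * x ^ ((k - 1) + (wt ks - length ks))"
    by (simp only: power_add length_Cons power_Suc mult_ac)
  finally show ?case
    unfolding exponent[symmetric] by simp
qed (simp add: index_weight_def)

lemma infsum_geometric_weights:
  fixes x c :: real
  assumes "0 \<le> x" "0 \<le> c" "x < n"
  shows "(\<Sum>\<^sub>\<infinity>k\<in>{0<..}. ennreal (c * x ^ (k - 1)) * ennreal (1 / n ^ k)) = ennreal (c / (n - x))"
proof -
  have "(\<lambda>k. c / n * (x / n) ^ k) sums (c / n * (1 / (1 - x / n)))"
    using assms by (intro sums_mult geometric_sums) simp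
  also have "c / n * (1 / (1 - x / n)) = c / (n - x)"
    using assms by (simp add: field_simps)
  finally have s: "(\<lambda>k. c / n * (x / n) ^ k) sums (c / (n - x))" .
  have "(\<Sum>\<^sub>\<infinity>k\<in>{0<..}. ennreal (c * x ^ (k - 1)) * ennreal (1 / n ^ k)) = (\<Sum>k. ennreal (c / n * (x / n) ^ k))"
    unfolding infsum_ennreal_suminf_Suc
    using assms by (intro suminf_cong) (simp add: ennreal_mult[symmetric] power_divide)
  also have "\<dots> = ennreal (c / (n - x))"
    using s assms by (intro sums_unique[symmetric]) (simp add: sums_ennreal)
  finally show ?thesis .
qed

lemma infsum_weak_head_fixed_length:
  fixes x y t :: real
  assumes "0 \<le> t" "0 \<le> y" "0 \<le> x" "x < 1" "0 < n"
  shows "(\<Sum>\<^sub>\<infinity>ks\<in>{ks. is_index ks \<and> length ks = j}. ennreal (index_weight x y ks) * weak_head t ks n)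
    = ennreal (head_gf (\<lambda>m. y / (real m - x)) t j n)"
  using assms(5)
proof (induction j arbitrary: n)
  case 0
  have "{ks. is_index ks \<and> length ks = 0} = {[]}" by (auto simp: is_index_def)
  then show ?case by (simp add: index_weight_def)
next
  case (Suc j)
  define U where "U m = y / (real m - x)" for m :: nat
  define P where "P = {ks. is_index ks \<and> length ks = j}"
  define a where "a m k = ennreal (y * x ^ (k - 1)) * ennreal (1 / real m ^ k)" for m k :: nat
  define b where "b m ks = ennreal (index_weight x y ks) * weak_head t ks m" for m ks
  have U: "0 \<le> U m" if "0 < m" for m using assms that by (auto simp: U_def)
  have asum: "(\<Sum>\<^sub>\<infinity>k\<in>{0<..}. a m k) = ennreal (U m)" if "0 < m" for m
    unfolding a_def U_def using that assms by (intro infsum_geometric_weights) auto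
  have bsum: "(\<Sum>\<^sub>\<infinity>ks\<in>P. b m ks) = ennreal (head_gf U t j m)" if "0 < m" for m
    using Suc.IH[OF that] by (simp add: P_def b_def U_def[abs_def])
  have w: "ennreal (index_weight x y (k # ks)) * weak_head t (k # ks) n
      = (\<Sum>m\<in>{0<..<n}. a m k * b m ks) + ennreal t * (a n k * b n ks)" for k ks
  proof -
    have "ennreal (index_weight x y (k # ks)) = ennreal (y * x ^ (k - 1)) * ennreal (index_weight x y ks)"
      using assms by (simp add: index_weight_def ennreal_mult')
    then show ?thesis
      by (simp add: a_def b_def distrib_left sum_distrib_left mult_ac)
  qed
  have ab: "(\<Sum>\<^sub>\<infinity>(k, ks)\<in>{0<..} \<times> P. a m k * b m ks) = ennreal (U m * head_gf U t j m)" if "0 < m" for m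
    unfolding infsum_ennreal_Sigma[symmetric] infsum_ennreal_cmult infsum_ennreal_multc asum[OF that] bsum[OF that]
    using that U by (simp add: ennreal_mult')
  have "(\<Sum>\<^sub>\<infinity>ks\<in>{ks. is_index ks \<and> length ks = Suc j}. ennreal (index_weight x y ks) * weak_head t ks n)
      = (\<Sum>\<^sub>\<infinity>(k, ks)\<in>{0<..} \<times> P. (\<Sum>m\<in>{0<..<n}. a m k * b m ks) + ennreal t * (a n k * b n ks))"
    unfolding w[symmetric]
    by (rule infsum_reindex_bij_witness[of _ "\<lambda>(k, ks). k # ks" "\<lambda>ks. (hd ks, tl ks)"])
       (auto simp: P_def is_index_def length_Suc_conv)
  also have "\<dots> = (\<Sum>m\<in>{0<..<n}. \<Sum>\<^sub>\<infinity>(k, ks)\<in>{0<..} \<times> P. a m k * b m ks)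
      + ennreal t * (\<Sum>\<^sub>\<infinity>(k, ks)\<in>{0<..} \<times> P. a n k * b n ks)"
    by (simp add: case_prod_unfold infsum_ennreal_add infsum_ennreal_sum infsum_ennreal_cmult)
  also have "\<dots> = (\<Sum>m\<in>{0<..<n}. ennreal (U m * head_gf U t j m)) + ennreal t * ennreal (U n * head_gf U t j n)"
    using ab Suc.prems by simp
  also have "\<dots> = ennreal (head_gf U t (Suc j) n)"
  proof -
    have pos: "0 \<le> U m * head_gf U t j m" if "0 < m" for m
      using that U head_gf_nonneg[of t U m j] assms(1) by auto
    then have "0 \<le> (\<Sum>m\<in>{0<..<n}. U m * head_gf U t j m)"
      by (intro sum_nonneg) auto
    moreover have "0 \<le> t * (U n * head_gf U t j n)"
      using pos[OF Suc.prems] assms(1) by simp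
    moreover have "(\<Sum>m\<in>{0<..<n}. ennreal (U m * head_gf U t j m)) = ennreal (\<Sum>m\<in>{0<..<n}. U m * head_gf U t j m)"
      using pos by (intro sum_ennreal) auto
    moreover have "ennreal t * ennreal (U n * head_gf U t j n) = ennreal (t * (U n * head_gf U t j n))"
      using assms(1) by (rule ennreal_mult'[symmetric])
    ultimately show ?thesis
      by (simp add: ennreal_plus mult.assoc del: ennreal_plus flip: ennreal_plus)
  qed
  finally show ?case by (simp only: U_def[abs_def])
qed

lemma infsum_weak_head:
  fixes x y t :: real
  assumes "0 \<le> t" "0 \<le> y" "0 \<le> x" "x < 1" "0 < n" "t * y < 1 - x"
  shows "(\<Sum>\<^sub>\<infinity>ks\<in>{ks. is_index ks}. ennreal (index_weight x y ks) * weak_head t ks n)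
    = ennreal ((\<Prod>m\<in>{0<..<n}. (real m - x + (1 - t) * y) / (real m - x - t * y)) * (real n - x) / (real n - x - t * y))"
proof -
  define U where "U m = y / (real m - x)" for m :: nat
  have pos: "0 < real m - x" "0 < real m - x - t * y" if "0 < m" for m :: nat
    using that assms by auto
  have "(\<lambda>j. head_gf U t j n) sums ((\<Prod>m\<in>{0<..<n}. 1 + U m / (1 - t * U m)) / (1 - t * U n))"
    using assms pos by (intro head_gf_sums) (auto simp: U_def divide_simps)
  also have "(\<Prod>m\<in>{0<..<n}. 1 + U m / (1 - t * U m)) = (\<Prod>m\<in>{0<..<n}. (real m - x + (1 - t) * y) / (real m - x - t * y))"
  proof (intro prod.cong refl)
    fix m assume "m \<in> {0<..<n}"
    then have "0 < m" by simp
    from pos[OF this] have "1 - t * U m = (real m - x - t * y) / (real m - x)"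
      by (simp add: U_def diff_divide_distrib)
    with pos[OF \<open>0 < m\<close>] have "U m / (1 - t * U m) = y / (real m - x - t * y)"
      by (simp add: U_def)
    with pos[OF \<open>0 < m\<close>] show "1 + U m / (1 - t * U m) = (real m - x + (1 - t) * y) / (real m - x - t * y)"
      by (simp add: add_divide_eq_iff algebra_simps)
  qed
  also have "\<dots> / (1 - t * U n) = \<dots> * (real n - x) / (real n - x - t * y)"
  proof -
    from pos[OF \<open>0 < n\<close>] have "1 - t * U n = (real n - x - t * y) / (real n - x)"
      by (simp add: U_def diff_divide_distrib)
    then show ?thesis by simp
  qed
  finally have s: "(\<lambda>j. head_gf U t j n) sums
     ((\<Prod>m\<in>{0<..<n}. (real m - x + (1 - t) * y) / (real m - x - t * y)) * (real n - x) / (real n - x - t * y))" (is "_ sums ?Q") .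
  have nonneg: "0 \<le> head_gf U t j n" for j
    using assms by (intro head_gf_nonneg) (auto simp: U_def)
  have "(\<Sum>\<^sub>\<infinity>ks\<in>{ks. is_index ks}. ennreal (index_weight x y ks) * weak_head t ks n)
     = (\<Sum>\<^sub>\<infinity>(j, ks)\<in>(SIGMA j:UNIV. {ks. is_index ks \<and> length ks = j}). ennreal (index_weight x y ks) * weak_head t ks n)"
    by (rule infsum_reindex_bij_witness[of _ snd "\<lambda>ks. (length ks, ks)"]) auto
  also have "\<dots> = (\<Sum>j. ennreal (head_gf U t j n))"
    unfolding infsum_ennreal_Sigma[symmetric] infsum_ennreal_suminf U_def
    using assms by (simp add: infsum_weak_head_fixed_length)
  also have "\<dots> = ennreal ?Q"
    using s nonneg sums_le[OF _ sums_zero s] by (intro sums_unique[symmetric]) (simp add: sums_ennreal)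
  finally show ?thesis .
qed

definition admissible :: "nat list set" where
  "admissible = {ks. is_index ks \<and> ks \<noteq> [] \<and> 2 \<le> last ks}"

text \<open>
  The last entry \<open>l\<close> contributes \<open>\<Sum>\<^bsub>l\<ge>2\<^esub> 2\<^sup>l y x\<^bsup>l-1\<^esup> / n\<^sup>l = 4 x y / (n (n - 2 x))\<close>, the others the
  product computed above.
\<close>

lemma infsum_admissible:
  fixes x y t :: real
  assumes "0 \<le> t" "0 \<le> y" "0 \<le> x" "x < 1 / 2" "t * y < 1 - x"
  shows "(\<Sum>\<^sub>\<infinity>ks\<in>admissible. ennreal (index_weight x y ks * 2 ^ last ks) * interp_tail t ks 0)
    = (\<Sum>\<^sub>\<infinity>n\<in>{0<..}. ennreal (4 * x * y / (real n * (real n - 2 * x))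
         * ((\<Prod>m\<in>{0<..<n}. (real m - x + (1 - t) * y) / (real m - x - t * y)) * (real n - x) / (real n - x - t * y))))"
proof -
  define Q where "Q n = (\<Prod>m\<in>{0<..<n}. (real m - x + (1 - t) * y) / (real m - x - t * y)) * (real n - x) / (real n - x - t * y)" for n
  define a where "a n l = ennreal (2 ^ l * y * x ^ (l - 1)) * ennreal (1 / real n ^ l)" for n l :: nat
  define b where "b n ks = ennreal (index_weight x y ks) * weak_head t ks n" for n ks
  have asum: "(\<Sum>\<^sub>\<infinity>l\<in>{2..}. a n l) = ennreal (4 * x * y / (real n * (real n - 2 * x)))" if "0 < n" for n
  proof -
    have n: "0 < real n" "2 * x < real n" using that assms by auto
    have "(\<Sum>\<^sub>\<infinity>l\<in>{2..}. a n l) = (\<Sum>\<^sub>\<infinity>k\<in>{0<..}. ennreal (4 * x * y / real n * (2 * x) ^ (k - 1)) * ennreal (1 / real n ^ k))"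
    proof (rule infsum_reindex_bij_witness[of _ "\<lambda>k. k + 1" "\<lambda>l. l - 1"])
      fix l :: nat assume "l \<in> {2..}"
      then obtain j where l: "l = j + 2" by (metis atLeast_iff add.commute nat_le_iff_add)
      show "ennreal (4 * x * y / real n * (2 * x) ^ ((l - 1) - 1)) * ennreal (1 / real n ^ (l - 1)) = a n l"
        using n assms unfolding a_def l by (simp add: ennreal_mult[symmetric] power_mult_distrib mult_ac)
    qed auto
    also have "\<dots> = ennreal (4 * x * y / real n / (real n - 2 * x))"
      using n assms by (intro infsum_geometric_weights) auto
    finally show ?thesis by simp
  qed
  have bsum: "(\<Sum>\<^sub>\<infinity>ks\<in>{ks. is_index ks}. b n ks) = ennreal (Q n)" if "0 < n" for n
    unfolding b_def Q_def using assms that by (intro infsum_weak_head) auto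
  have w: "ennreal (index_weight x y (rev ks @ [l]) * 2 ^ last (rev ks @ [l])) * interp_tail t (rev ks @ [l]) 0
     = (\<Sum>\<^sub>\<infinity>n\<in>{0<..}. a n l * b n ks)" for ks l
  proof -
    have "index_weight x y (rev ks @ [l]) = index_weight x y ks * (y * x ^ (l - 1))"
    proof -
      have "index_weight x y (rev ks) = index_weight x y ks"
        by (induction ks) (simp_all add: index_weight_def)
      then show ?thesis by (simp add: index_weight_def)
    qed
    then have "ennreal (index_weight x y (rev ks @ [l]) * 2 ^ last (rev ks @ [l]))
       = ennreal (index_weight x y ks) * ennreal (2 ^ l * y * x ^ (l - 1))"
      using assms by (simp add: ennreal_mult''[symmetric] mult_ac)
    then show ?thesis
      unfolding interp_tail_snoc[OF assms(1)] infsum_ennreal_cmult[symmetric]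
      by (simp add: a_def b_def mult_ac)
  qed
  have "(\<Sum>\<^sub>\<infinity>ks\<in>admissible. ennreal (index_weight x y ks * 2 ^ last ks) * interp_tail t ks 0)
     = (\<Sum>\<^sub>\<infinity>(l, ks)\<in>{2..} \<times> {ks. is_index ks}. \<Sum>\<^sub>\<infinity>n\<in>{0<..}. a n l * b n ks)"
    unfolding w[symmetric]
    by (rule infsum_reindex_bij_witness[of _ "\<lambda>(l, ks). rev ks @ [l]" "\<lambda>ks. (last ks, rev (butlast ks))"])
       (auto simp: admissible_def is_index_def dest: in_set_butlastD)
  also have "\<dots> = (\<Sum>\<^sub>\<infinity>n\<in>{0<..}. \<Sum>\<^sub>\<infinity>(l, ks)\<in>{2..} \<times> {ks. is_index ks}. a n l * b n ks)"
    by (simp add: case_prod_unfold infsum_ennreal_swap[of _ "{0<..}"])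
  also have "\<dots> = (\<Sum>\<^sub>\<infinity>n\<in>{0<..}. ennreal (4 * x * y / (real n * (real n - 2 * x))) * ennreal (Q n))"
    unfolding infsum_ennreal_Sigma[symmetric] infsum_ennreal_cmult infsum_ennreal_multc
    by (intro infsum_cong) (simp add: asum bsum)
  also have "\<dots> = (\<Sum>\<^sub>\<infinity>n\<in>{0<..}. ennreal (4 * x * y / (real n * (real n - 2 * x)) * Q n))"
    using assms by (intro infsum_cong ennreal_mult'[symmetric]) auto
  finally show ?thesis by (simp only: Q_def)
qed

text \<open>
  Evaluating at one positive point shows that all coefficients are finite. The difference of the real
  power series vanishes on an interval ending at \<open>0\<close>, while zeros of a nontrivial power series are
  isolated.
\<close>

lemma ennreal_power_series_unique:
  fixes a b :: "nat \<Rightarrow> ennreal"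
  assumes "0 < \<delta>"
    and eq: "\<And>s. 0 < s \<Longrightarrow> s < \<delta> \<Longrightarrow> (\<Sum>n. ennreal (s ^ n) * a n) = (\<Sum>n. ennreal (s ^ n) * b n)"
    and fin: "\<And>s. 0 < s \<Longrightarrow> s < \<delta> \<Longrightarrow> (\<Sum>n. ennreal (s ^ n) * b n) \<noteq> top"
  shows "a = b"
proof -
  have real_sums: "\<exists>c'. (\<forall>n. c n = ennreal (c' n) \<and> 0 \<le> c' n) \<and>
      (\<forall>s. 0 < s \<longrightarrow> s < \<delta> \<longrightarrow> (\<lambda>n. c' n * s ^ n) sums enn2real (\<Sum>n. ennreal (s ^ n) * c n))"
    if c: "\<And>s. 0 < s \<Longrightarrow> s < \<delta> \<Longrightarrow> (\<Sum>n. ennreal (s ^ n) * c n) \<noteq> top" for c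
  proof (intro exI conjI allI impI)
    show c_eq: "c n = ennreal (enn2real (c n))" for n
    proof -
      have "ennreal ((\<delta> / 2) ^ n) * c n \<noteq> top"
        using ennreal_suminf_lessD[of "\<lambda>n. ennreal ((\<delta> / 2) ^ n) * c n" top n] c[of "\<delta> / 2"] \<open>0 < \<delta>\<close>
        by (simp add: less_top)
      then have "c n \<noteq> top"
        using \<open>0 < \<delta>\<close> by (auto simp: ennreal_mult_top)
      then show ?thesis by (simp add: less_top)
    qed
    fix s :: real assume s: "0 < s" "s < \<delta>"
    define T where "T = enn2real (\<Sum>n. ennreal (s ^ n) * c n)"
    have "(\<lambda>n. ennreal (s ^ n) * c n) sums (\<Sum>n. ennreal (s ^ n) * c n)"
      by (intro summable_sums) simp
    also have "(\<Sum>n. ennreal (s ^ n) * c n) = ennreal T"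
      using c[OF s] by (simp add: T_def less_top)
    also have "(\<lambda>n. ennreal (s ^ n) * c n) = (\<lambda>n. ennreal (enn2real (c n) * s ^ n))"
      using s by (subst c_eq) (simp add: ennreal_mult'' mult.commute)
    finally show "(\<lambda>n. enn2real (c n) * s ^ n) sums T"
      using s by (subst (asm) sums_ennreal) (auto simp: T_def)
  qed auto
  obtain a' where a': "\<And>n. a n = ennreal (a' n)" "\<And>n. 0 \<le> a' n"
      "\<And>s. 0 < s \<Longrightarrow> s < \<delta> \<Longrightarrow> (\<lambda>n. a' n * s ^ n) sums enn2real (\<Sum>n. ennreal (s ^ n) * a n)"
    using real_sums[of a] eq fin by auto
  obtain b' where b': "\<And>n. b n = ennreal (b' n)" "\<And>n. 0 \<le> b' n"
      "\<And>s. 0 < s \<Longrightarrow> s < \<delta> \<Longrightarrow> (\<lambda>n. b' n * s ^ n) sums enn2real (\<Sum>n. ennreal (s ^ n) * b n)"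
    using real_sums[of b] fin by auto
  \<comment> \<open>Multiplying the difference by the variable gives a series that visibly vanishes at \<open>0\<close>.\<close>
  define d where "d n = (if n = 0 then 0 else a' (n - 1) - b' (n - 1))" for n
  define f where "f x = (\<Sum>n. d n * x ^ n)" for x :: real
  have d0: "(\<lambda>n. d n * s ^ n) sums 0" if "0 < s" "s < \<delta>" for s
  proof -
    have "(\<lambda>n. a' n * s ^ n - b' n * s ^ n) sums 0"
      using sums_diff[OF a'(3)[OF that] b'(3)[OF that]] eq[OF that] by simp
    from sums_mult[OF this, of s] have "(\<lambda>n. d (Suc n) * s ^ Suc n) sums 0"
      by (simp add: d_def algebra_simps)
    then show ?thesis by (subst (asm) sums_Suc_iff) (simp add: d_def)
  qed
  have sums_f: "(\<lambda>n. d n * (x - 0) ^ n) sums f x" if "norm (x - 0) < \<delta>" for x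
  proof -
    define s where "s = (norm x + \<delta>) / 2"
    have "0 < s" "s < \<delta>" "norm x < norm s" using that by (auto simp: s_def)
    then have "summable (\<lambda>n. d n * x ^ n)"
      using d0[of s] by (intro powser_inside[of d s x]) (auto simp: sums_iff)
    then show ?thesis by (simp add: f_def summable_sums)
  qed
  have "d m = 0" if "0 < m" for m
  proof (rule ccontr)
    assume "d m \<noteq> 0"
    have "f 0 = 0" by (simp add: f_def d_def)
    from powser_0_nonzero[OF \<open>0 < \<delta>\<close> sums_f this \<open>d m \<noteq> 0\<close> that]
    obtain s where s: "0 < s" "\<And>z. z \<in> cball 0 s - {0} \<Longrightarrow> f z \<noteq> 0" by metis
    define z where "z = min s (\<delta> / 2)"
    have "f z \<noteq> 0" using s \<open>0 < \<delta>\<close> by (intro s(2)) (auto simp: z_def)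
    moreover have "0 < z" "z < \<delta>"
      using s(1) \<open>0 < \<delta>\<close> by (auto simp: z_def)
    then have "f z = 0" using d0[of z] by (simp add: f_def sums_iff)
    ultimately show False by simp
  qed
  from this[of "Suc _"] have "a' n = b' n" for n by (simp add: d_def)
  then show ?thesis by (simp add: fun_eq_iff a'(1) b'(1))
qed

section \<open>Comparison of coefficients\<close>

lemma mzv_single:
  assumes "2 \<le> k"
  shows "mzv [k] = (\<Sum>m. 1 / real (Suc m) ^ k)"
proof -
  have summ: "summable (\<lambda>m. 1 / real (Suc m) ^ k)"
    using summable_Suc_iff[THEN iffD2, OF inverse_power_summable[OF assms, where 'a = real]]
    by (simp add: inverse_eq_divide)
  have "tail_mzv [k] 0 = (\<Sum>m. ennreal (1 / real (Suc m) ^ k))"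
    by (simp add: tail_mzv_Cons tail_mzv_Nil infsum_ennreal_suminf_Suc)
  also have "\<dots> = ennreal (\<Sum>m. 1 / real (Suc m) ^ k)"
    using summ by (intro suminf_ennreal2) auto
  finally have *: "tail_mzv [k] 0 = ennreal (\<Sum>m. 1 / real (Suc m) ^ k)" .
  have "ennreal (mzv [k]) = ennreal (\<Sum>m. 1 / real (Suc m) ^ k)"
    using ennreal_mzv[of "[k]"] * by simp
  moreover have "0 \<le> mzv [k]"
    unfolding mzv_def by (intro infsum_nonneg) (auto intro!: divide_nonneg_nonneg prod_nonneg)
  ultimately show ?thesis
    using summ by (subst (asm) ennreal_inj) (auto intro!: suminf_nonneg)
qed

text \<open>
  The right-hand side of the theorem without the power of two.
\<close>

definition sum_formula_coeff :: "nat \<Rightarrow> nat \<Rightarrow> real" where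
  "sum_formula_coeff k r = (2 ^ (k - 1) - 1 + (\<Sum>j<r. real ((k - 1) choose j))) * mzv [k]"

text \<open>
  Nonnegativity is what allows the closed form to be read in the extended nonnegative reals.
\<close>

lemma sum_formula_coeff_nonneg: "0 \<le> sum_formula_coeff k r"
proof -
  have "(1::real) \<le> 2 ^ (k - 1)" by simp
  moreover have "0 \<le> mzv [k]"
    unfolding mzv_def by (intro infsum_nonneg) (auto intro!: divide_nonneg_nonneg prod_nonneg)
  ultimately show ?thesis
    unfolding sum_formula_coeff_def by (intro mult_nonneg_nonneg add_nonneg_nonneg sum_nonneg) auto
qed

lemma total_gf_eq_poch_series:
  fixes x z :: real
  assumes xz: "0 < x" "x < z" "z < 1 / 2"
  shows "(\<Sum>\<^sub>\<infinity>ks\<in>admissible. ennreal (index_weight x (2 * z) ks * 2 ^ last ks) * interp_tail (1 / 2) ks 0)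
    = ennreal (4 * x * z / (z - x) * (poch_series 1 (z - x) (1 - x - z) + poch_series (1 - 2 * x) (z - x) (1 - x - z)))"
proof -
  define a where "a = z - x"
  define b where "b = 1 - x - z"
  have ab: "0 < a" "a < b" using xz by (auto simp: a_def b_def)
  define p where "p n = pochhammer a (Suc n) / pochhammer b (Suc n)" for n
  define T where "T n = 4 * x * (2 * z) / (real n * (real n - 2 * x))
         * ((\<Prod>m\<in>{0<..<n}. (real m - x + (1 - 1/2) * (2 * z)) / (real m - x - 1/2 * (2 * z))) * (real n - x) / (real n - x - 1/2 * (2 * z)))" for n
  have T: "T (Suc n) = 4 * x * z / a * (p n / (1 + real n) + p n / (1 - 2 * x + real n))" for n
  proof -
    have "(\<Prod>m\<in>{0<..<Suc n}. (real m - x + (1 - 1/2) * (2 * z)) / (real m - x - 1/2 * (2 * z)))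
       = (\<Prod>i<n. (a + 1 + real i) / (b + real i))"
      by (rule prod.reindex_bij_witness[of _ Suc "\<lambda>m. m - 1"]) (auto simp: a_def b_def algebra_simps of_nat_diff)
    also have "\<dots> = pochhammer (a + 1) n / pochhammer b n"
      by (simp add: pochhammer_prod prod_dividef lessThan_atLeast0)
    finally have P: "(\<Prod>m\<in>{0<..<Suc n}. (real m - x + (1 - 1/2) * (2 * z)) / (real m - x - 1/2 * (2 * z)))
       = pochhammer (a + 1) n / pochhammer b n" .
    have pos: "0 < 1 + real n" "0 < 1 - 2 * x + real n" "0 < b + real n" using xz by (auto simp: b_def)
    have pn: "p n = a * (pochhammer (a + 1) n / pochhammer b n) / (b + real n)"
      unfolding p_def pochhammer_rec[of a] pochhammer_Suc[of b] by simp
    define R where "R = pochhammer (a + 1) n / pochhammer b n"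
    \<comment> \<open>The partial fraction decomposition that splits the generating function into two series.\<close>
    have frac: "2 * (1 + real n - x) / ((1 + real n) * (1 - 2 * x + real n)) = 1 / (1 + real n) + 1 / (1 - 2 * x + real n)"
      using pos by (simp add: divide_simps)
    have "T (Suc n) = 4 * x * z * R / (b + real n) * (2 * (1 + real n - x) / ((1 + real n) * (1 - 2 * x + real n)))"
      unfolding T_def P R_def[symmetric] by (simp add: b_def algebra_simps)
    also have "\<dots> = 4 * x * z * R / (b + real n) * (1 / (1 + real n) + 1 / (1 - 2 * x + real n))"
      by (simp only: frac)
    also have "\<dots> = 4 * x * z / a * (p n / (1 + real n) + p n / (1 - 2 * x + real n))"
      unfolding pn R_def[symmetric] using ab by (simp add: distrib_left)
    finally show ?thesis .
  qed
  have "(\<lambda>n. T (Suc n)) sums (4 * x * z / a * (poch_series 1 a b + poch_series (1 - 2 * x) a b))"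
    unfolding T p_def poch_series_def using ab xz
    by (intro sums_mult sums_add summable_sums summable_poch_series) auto
  moreover have "0 \<le> T (Suc n)" for n
    unfolding T p_def using ab xz
    by (intro mult_nonneg_nonneg add_nonneg_nonneg divide_nonneg_nonneg pochhammer_nonneg) auto
  ultimately have "(\<lambda>n. ennreal (T (Suc n))) sums ennreal (4 * x * z / a * (poch_series 1 a b + poch_series (1 - 2 * x) a b))"
    by (rule ennreal_sums)
  then have "(\<Sum>\<^sub>\<infinity>n\<in>{0<..}. ennreal (T n)) = ennreal (4 * x * z / a * (poch_series 1 a b + poch_series (1 - 2 * x) a b))"
    unfolding infsum_ennreal_suminf_Suc by (rule sums_unique[symmetric])
  moreover have "(\<Sum>\<^sub>\<infinity>ks\<in>admissible. ennreal (index_weight x (2 * z) ks * 2 ^ last ks) * interp_tail (1 / 2) ks 0)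
     = (\<Sum>\<^sub>\<infinity>n\<in>{0<..}. ennreal (T n))"
    unfolding T_def using xz by (intro infsum_admissible) auto
  ultimately show ?thesis by (simp add: a_def b_def)
qed

lemma total_gf_eq_zeta_series:
  fixes x z :: real
  assumes xz: "0 < x" "x < z" "z < 1 / 2"
  shows "(\<lambda>k. 4 * (\<Sum>r=1..k + 1. x ^ (k + 2 - r) * z ^ r * sum_formula_coeff (k + 2) r))
    sums (4 * x * z / (z - x) * (poch_series 1 (z - x) (1 - x - z) + poch_series (1 - 2 * x) (z - x) (1 - x - z)))"
proof -
  have "4 * (\<Sum>r=1..k + 1. x ^ (k + 2 - r) * z ^ r * sum_formula_coeff (k + 2) r)
     = 4 * x * z / (z - x) * ((2 * (2 * z) ^ (k + 1) - z ^ (k + 1) - (2 ^ (k + 1) - 1) * x ^ (k + 1) - (x + z) ^ (k + 1))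
              * (\<Sum>m. 1 / real (Suc m) ^ (k + 2)))" (is "?l = ?r") for k
  proof -
    define Z where "Z = (\<Sum>m. 1 / real (Suc m) ^ (k + 2))"
    have coeff: "sum_formula_coeff (k + 2) r = Z * (2 ^ (k + 1) - 1 + (\<Sum>j<r. real ((k + 1) choose j)))" for r
      by (simp add: sum_formula_coeff_def mzv_single Z_def)
    have e: "k + 2 = k + 1 + 1" by simp
    have "(z - x) * ?l = 4 * Z * ((z - x) * (\<Sum>r=1..k + 1. x ^ (k + 1 + 1 - r) * z ^ r * (2 ^ (k + 1) - 1 + (\<Sum>j<r. real ((k + 1) choose j)))))"
      unfolding coeff by (simp only: e sum_distrib_left mult_ac)
    also have "\<dots> = 4 * Z * (x * z * ((2 ^ (k + 1) - 1 + 2 ^ (k + 1)) * z ^ (k + 1) - (2 ^ (k + 1) - 1) * x ^ (k + 1) - (x + z) ^ (k + 1)))"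
      unfolding binomial_partial_sum_telescope ..
    also have "\<dots> = (z - x) * ?r"
      unfolding Z_def[symmetric] using xz by (simp add: power_mult_distrib) (simp add: algebra_simps)
    finally have "(z - x) * ?l = (z - x) * ?r" .
    moreover have "z - x \<noteq> 0" using xz by simp
    ultimately show ?thesis using mult_left_cancel by blast
  qed
  then show ?thesis
    using sums_mult[OF poch_series_zeta_expansion[OF xz], of "4 * x * z / (z - x)"] by simp
qed

definition index_sum :: "nat \<Rightarrow> nat \<Rightarrow> ennreal" where
  "index_sum k r = (\<Sum>ks\<in>index_set r k r. ennreal (2 ^ last ks) * interp_tail (1 / 2) ks 0)"

lemma infsum_admissible_by_weight:
  assumes "0 \<le> x" "0 \<le> y"
  shows "(\<Sum>\<^sub>\<infinity>ks\<in>admissible. ennreal (index_weight x y ks * 2 ^ last ks) * interp_tail (1 / 2) ks 0)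
    = (\<Sum>k. \<Sum>r=1..k + 1. ennreal (x ^ (k + 2 - r) * y ^ r) * index_sum (k + 2) r)"
proof -
  define h where "h ks = ennreal (index_weight x y ks * 2 ^ last ks) * interp_tail (1 / 2) ks 0" for ks
  have idx: "ks \<in> index_set r k r \<longleftrightarrow> ks \<in> admissible \<and> wt ks = k \<and> length ks = r" if "0 < r" for ks k r
    using that by (auto simp: index_set_def admissible_def last_conv_nth)
  have range: "\<exists>k. wt ks = k + 2 \<and> length ks \<le> k + 1 \<and> 1 \<le> length ks" if "ks \<in> admissible" for ks
  proof -
    define js l where "js = butlast ks" and "l = last ks"
    with that have ks: "ks = js @ [l]" "is_index js" "2 \<le> l"
      by (auto simp: admissible_def is_index_def dest: in_set_butlastD)
    have "length js \<le> wt js"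
      using ks(2) sum_list_mono[of js "\<lambda>_. 1" "\<lambda>k. k"] by (simp add: is_index_def sum_list_triv Suc_le_eq)
    then show ?thesis using ks by (intro exI[of _ "wt ks - 2"]) auto
  qed
  have "(\<Sum>\<^sub>\<infinity>ks\<in>admissible. h ks)
     = (\<Sum>\<^sub>\<infinity>(k, ks)\<in>(SIGMA k:UNIV. {ks \<in> admissible. wt ks = k + 2}). h ks)"
    using range by (intro infsum_reindex_bij_witness[of _ snd "\<lambda>ks. (wt ks - 2, ks)"]) force+
  also have "\<dots> = (\<Sum>k. \<Sum>\<^sub>\<infinity>ks\<in>{ks \<in> admissible. wt ks = k + 2}. h ks)"
    unfolding infsum_ennreal_Sigma[symmetric] infsum_ennreal_suminf ..
  also have "(\<lambda>k. \<Sum>\<^sub>\<infinity>ks\<in>{ks \<in> admissible. wt ks = k + 2}. h ks)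
     = (\<lambda>k. \<Sum>r=1..k + 1. ennreal (x ^ (k + 2 - r) * y ^ r) * index_sum (k + 2) r)"
  proof
    fix k
    have eq: "{ks \<in> admissible. wt ks = k + 2} = (\<Union>r\<in>{1..k + 1}. index_set r (k + 2) r)"
      using range by (fastforce simp: idx)
    have "(\<Sum>\<^sub>\<infinity>ks\<in>{ks \<in> admissible. wt ks = k + 2}. h ks) = (\<Sum>ks\<in>(\<Union>r\<in>{1..k + 1}. index_set r (k + 2) r). h ks)"
      unfolding eq by (intro infsum_finite finite_UN_I finite_index_set) auto
    also have "\<dots> = (\<Sum>r=1..k + 1. \<Sum>ks\<in>index_set r (k + 2) r. h ks)"
      by (intro sum.UNION_disjoint finite_index_set ballI) (auto simp: index_set_def)
    also have "\<dots> = (\<Sum>r=1..k + 1. ennreal (x ^ (k + 2 - r) * y ^ r) * index_sum (k + 2) r)"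
    proof (intro sum.cong refl)
      fix r assume "r \<in> {1..k + 1}"
      show "(\<Sum>ks\<in>index_set r (k + 2) r. h ks) = ennreal (x ^ (k + 2 - r) * y ^ r) * index_sum (k + 2) r"
        unfolding index_sum_def sum_distrib_left
      proof (intro sum.cong refl)
        fix ks assume "ks \<in> index_set r (k + 2) r"
        then have "is_index ks" "wt ks = k + 2" "length ks = r" by (auto simp: index_set_def)
        then have "index_weight x y ks = x ^ (k + 2 - r) * y ^ r" by (simp add: index_weight_eq)
        then show "h ks = ennreal (x ^ (k + 2 - r) * y ^ r) * (ennreal (2 ^ last ks) * interp_tail (1 / 2) ks 0)"
          using assms by (simp add: h_def ennreal_mult mult.assoc)
      qed
    qed
    finally show "(\<Sum>\<^sub>\<infinity>ks\<in>{ks \<in> admissible. wt ks = k + 2}. h ks)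
      = (\<Sum>r=1..k + 1. ennreal (x ^ (k + 2 - r) * y ^ r) * index_sum (k + 2) r)" .
  qed
  finally show ?thesis by (simp only: h_def)
qed

text \<open>
  Along the ray \<open>(s x, s z)\<close> the parts of weight \<open>k + 2\<close> scale like \<open>s\<^bsup>k + 2\<^esup>\<close>, so the generating
  functions become power series in \<open>s\<close>.
\<close>

lemma homogeneous_parts_eq:
  fixes x z :: real
  assumes xz: "0 < x" "x < z" "z < 1 / 2"
  shows "(\<Sum>r=1..k + 1. ennreal (x ^ (k + 2 - r) * (2 * z) ^ r) * index_sum (k + 2) r)
    = (\<Sum>r=1..k + 1. ennreal (4 * (x ^ (k + 2 - r) * z ^ r * sum_formula_coeff (k + 2) r)))"
proof -
  define L where "L x z k = (\<Sum>r=1..k + 1. ennreal (x ^ (k + 2 - r) * (2 * z) ^ r) * index_sum (k + 2) r)" for x z k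
  define R where "R x z k = (\<Sum>r=1..k + 1. ennreal (4 * (x ^ (k + 2 - r) * z ^ r * sum_formula_coeff (k + 2) r)))" for x z k
  have total: "(\<Sum>k. L x z k) = (\<Sum>k. R x z k)" "(\<Sum>k. R x z k) \<noteq> top"
    if "0 < x" "x < z" "z < 1 / 2" for x z :: real
  proof -
    define S where "S = 4 * x * z / (z - x) * (poch_series 1 (z - x) (1 - x - z) + poch_series (1 - 2 * x) (z - x) (1 - x - z))"
    have "R x z k = ennreal (4 * (\<Sum>r=1..k + 1. x ^ (k + 2 - r) * z ^ r * sum_formula_coeff (k + 2) r))" for k
      unfolding R_def sum_distrib_left using that sum_formula_coeff_nonneg
      by (intro sum_ennreal) auto
    moreover have "0 \<le> 4 * (\<Sum>r=1..k + 1. x ^ (k + 2 - r) * z ^ r * sum_formula_coeff (k + 2) r)" for k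
      using that sum_formula_coeff_nonneg by (intro mult_nonneg_nonneg sum_nonneg) auto
    ultimately have "(\<lambda>k. R x z k) sums ennreal S"
      using ennreal_sums[OF total_gf_eq_zeta_series[OF that]] unfolding S_def by simp
    moreover have "(\<Sum>k. L x z k) = ennreal S"
      unfolding L_def S_def total_gf_eq_poch_series[OF that, symmetric] using that
      by (intro infsum_admissible_by_weight[symmetric]) auto
    ultimately show "(\<Sum>k. L x z k) = (\<Sum>k. R x z k)" "(\<Sum>k. R x z k) \<noteq> top"
      by (auto simp: sums_iff)
  qed
  have scale: "L (s * x) (s * z) k = ennreal (s ^ k) * (ennreal (s ^ 2) * L x z k)"
    "R (s * x) (s * z) k = ennreal (s ^ k) * (ennreal (s ^ 2) * R x z k)" if "0 < s" for s k
  proof -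
    have pow: "s ^ (k + 2 - r) * s ^ r = s ^ k * s ^ 2" if "r \<in> {1..k + 1}" for r
      using that by (simp flip: power_add)
    have L: "(s * x) ^ (k + 2 - r) * (2 * (s * z)) ^ r = s ^ k * (s ^ 2 * (x ^ (k + 2 - r) * (2 * z) ^ r))"
      and R: "4 * ((s * x) ^ (k + 2 - r) * (s * z) ^ r * sum_formula_coeff (k + 2) r)
        = s ^ k * (s ^ 2 * (4 * (x ^ (k + 2 - r) * z ^ r * sum_formula_coeff (k + 2) r)))"
      if "r \<in> {1..k + 1}" for r
      using pow[OF that] by (simp_all add: power_mult_distrib mult_ac)
    have split: "ennreal (s ^ k * (s ^ 2 * w)) = ennreal (s ^ k) * (ennreal (s ^ 2) * ennreal w)" for w
      using that by (simp add: ennreal_mult')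
    show "L (s * x) (s * z) k = ennreal (s ^ k) * (ennreal (s ^ 2) * L x z k)"
      unfolding L_def sum_distrib_left by (intro sum.cong refl) (simp only: L split mult.assoc)
    show "R (s * x) (s * z) k = ennreal (s ^ k) * (ennreal (s ^ 2) * R x z k)"
      unfolding R_def sum_distrib_left by (intro sum.cong refl) (simp only: R split)
  qed
  have "(\<lambda>k. L x z k) = (\<lambda>k. R x z k)"
  proof (rule ennreal_power_series_unique[of 1])
    fix s :: real assume s: "0 < s" "s < 1"
    have sxz: "0 < s * x" "s * x < s * z" "s * z < 1 / 2"
      using s xz mult_strict_mono[of s 1 z "1 / 2"] by auto
    have s2: "ennreal (s ^ 2) \<noteq> 0" "ennreal (s ^ 2) \<noteq> top" using s by auto
    have eq: "ennreal (s ^ 2) * (\<Sum>k. ennreal (s ^ k) * L x z k) = (\<Sum>k. L (s * x) (s * z) k)"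
      "ennreal (s ^ 2) * (\<Sum>k. ennreal (s ^ k) * R x z k) = (\<Sum>k. R (s * x) (s * z) k)"
      using s by (simp_all add: scale mult.left_commute flip: ennreal_suminf_cmult)
    with total(1)[OF sxz] have "ennreal (s ^ 2) * (\<Sum>k. ennreal (s ^ k) * L x z k) = ennreal (s ^ 2) * (\<Sum>k. ennreal (s ^ k) * R x z k)"
      by simp
    then show "(\<Sum>k. ennreal (s ^ k) * L x z k) = (\<Sum>k. ennreal (s ^ k) * R x z k)"
      using s2 by (simp add: ennreal_mult_cancel_left)
    show "(\<Sum>k. ennreal (s ^ k) * R x z k) \<noteq> top"
      using total(2)[OF sxz] s2 unfolding eq(2)[symmetric] by (auto simp: ennreal_mult_top)
  qed simp
  then show ?thesis unfolding L_def R_def by (rule fun_cong)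
qed

text \<open>
  For fixed \<open>z\<close> the parts of weight \<open>k + 2\<close> are polynomials in \<open>x\<close> that agree on an interval. Any \<open>z\<close>
  below \<open>1/2\<close> will do.
\<close>

lemma index_sum_eq:
  assumes "r \<in> {1..k + 1}"
  shows "index_sum (k + 2) r = ennreal (4 / 2 ^ r * sum_formula_coeff (k + 2) r)"
proof -
  define z where "z = (1 / 4 :: real)"
  define a where "a i = (if i \<in> {1..k + 1} then ennreal ((2 * z) ^ (k + 2 - i)) * index_sum (k + 2) (k + 2 - i) else 0)" for i
  define b where "b i = (if i \<in> {1..k + 1} then ennreal (4 * (z ^ (k + 2 - i) * sum_formula_coeff (k + 2) (k + 2 - i))) else 0)" for i
  have "a = b"
  proof (rule ennreal_power_series_unique[of z])
    fix x :: real assume x: "0 < x" "x < z"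
    have A: "(\<Sum>i. ennreal (x ^ i) * a i) = (\<Sum>r=1..k + 1. ennreal (x ^ (k + 2 - r) * (2 * z) ^ r) * index_sum (k + 2) r)"
    proof -
      have "(\<Sum>i. ennreal (x ^ i) * a i) = (\<Sum>i=1..k + 1. ennreal (x ^ i) * a i)"
        by (intro suminf_finite) (auto simp: a_def)
      also have "\<dots> = (\<Sum>r=1..k + 1. ennreal (x ^ (k + 2 - r) * (2 * z) ^ r) * index_sum (k + 2) r)"
        by (rule sum.reindex_bij_witness[of _ "\<lambda>r. k + 2 - r" "\<lambda>i. k + 2 - i"])
           (use x in \<open>auto simp: a_def z_def ennreal_mult mult_ac\<close>)
      finally show ?thesis .
    qed
    have B: "(\<Sum>i. ennreal (x ^ i) * b i) = (\<Sum>r=1..k + 1. ennreal (4 * (x ^ (k + 2 - r) * z ^ r * sum_formula_coeff (k + 2) r)))"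
    proof -
      have "(\<Sum>i. ennreal (x ^ i) * b i) = (\<Sum>i=1..k + 1. ennreal (x ^ i) * b i)"
        by (intro suminf_finite) (auto simp: b_def)
      also have "\<dots> = (\<Sum>r=1..k + 1. ennreal (4 * (x ^ (k + 2 - r) * z ^ r * sum_formula_coeff (k + 2) r)))"
        by (rule sum.reindex_bij_witness[of _ "\<lambda>r. k + 2 - r" "\<lambda>i. k + 2 - i"])
           (use x in \<open>auto simp: b_def z_def ennreal_mult'[symmetric] mult_ac\<close>)
      finally show ?thesis .
    qed
    show "(\<Sum>i. ennreal (x ^ i) * a i) = (\<Sum>i. ennreal (x ^ i) * b i)"
      unfolding A B using x by (intro homogeneous_parts_eq) (auto simp: z_def)
    show "(\<Sum>i. ennreal (x ^ i) * b i) \<noteq> top"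
      unfolding B by (simp add: ennreal_sum_eq_top)
  qed (simp add: z_def)
  then have "a (k + 2 - r) = b (k + 2 - r)" by simp
  moreover have "k + 2 - r \<in> {1..k + 1}" "k + 2 - (k + 2 - r) = r" using assms by auto
  ultimately have *: "ennreal ((2 * z) ^ r) * index_sum (k + 2) r = ennreal (4 * (z ^ r * sum_formula_coeff (k + 2) r))"
    by (simp add: a_def b_def)
  also have "4 * (z ^ r * sum_formula_coeff (k + 2) r) = (2 * z) ^ r * (4 / 2 ^ r * sum_formula_coeff (k + 2) r)"
    by (simp add: power_mult_distrib)
  also have "ennreal \<dots> = ennreal ((2 * z) ^ r) * ennreal (4 / 2 ^ r * sum_formula_coeff (k + 2) r)"
    by (rule ennreal_mult') (simp add: z_def)
  finally have "ennreal ((2 * z) ^ r) * index_sum (k + 2) r = ennreal ((2 * z) ^ r) * ennreal (4 / 2 ^ r * sum_formula_coeff (k + 2) r)" .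
  then show ?thesis
    by (simp add: ennreal_mult_cancel_left z_def)
qed

theorem theorem1p1:
  fixes k r :: nat
  assumes "0 < r" and "r < k"
  shows "(\<Sum>ks \<in> index_set r k r. 2 ^ last ks * interpolated_mzv (1 / 2) ks) =
         1 / 2 powi (int r - 2) *
         (2 ^ (k - 1) - 1 + (\<Sum>n = 0..r - 1. real ((k - 1) choose n))) * mzv [k]"
proof -
  have q: "k = (k - 2) + 2" using assms by simp
  have eq: "index_sum k r = ennreal (4 / 2 ^ r * sum_formula_coeff k r)"
    using assms index_sum_eq[of r "k - 2"] q[symmetric] by simp
  have fin: "interp_tail (1 / 2) ks 0 \<noteq> top" if "ks \<in> index_set r k r" for ks
  proof
    assume top: "interp_tail (1 / 2) ks 0 = top"
    have "ennreal (2 ^ last ks) * interp_tail (1 / 2) ks 0 \<le> index_sum k r"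
      unfolding index_sum_def using that finite_index_set by (intro member_le_sum) auto
    then show False
      unfolding eq top by (simp add: ennreal_mult_top top_unique)
  qed
  have "ennreal (\<Sum>ks\<in>index_set r k r. 2 ^ last ks * interpolated_mzv (1 / 2) ks)
     = (\<Sum>ks\<in>index_set r k r. ennreal (2 ^ last ks * interpolated_mzv (1 / 2) ks))"
    using fin ennreal_interpolated_mzv(2)[of "1 / 2"] by (intro sum_ennreal[symmetric]) auto
  also have "\<dots> = index_sum k r"
    unfolding index_sum_def using fin ennreal_interpolated_mzv[of "1 / 2"]
    by (intro sum.cong refl) (simp add: ennreal_mult)
  also note eq
  finally have "(\<Sum>ks\<in>index_set r k r. 2 ^ last ks * interpolated_mzv (1 / 2) ks) = 4 / 2 ^ r * sum_formula_coeff k r"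
    using fin ennreal_interpolated_mzv(2)[of "1 / 2"] sum_formula_coeff_nonneg
    by (subst (asm) ennreal_inj) (auto intro!: sum_nonneg)
  also have "4 / 2 ^ r = 1 / (2 powi (int r - 2) :: real)"
    by (simp add: power_int_diff)
  also have "{..<r} = {0..r - 1}" using assms by auto
  then have "sum_formula_coeff k r = (2 ^ (k - 1) - 1 + (\<Sum>n = 0..r - 1. real ((k - 1) choose n))) * mzv [k]"
    by (simp add: sum_formula_coeff_def)
  finally show ?thesis by (simp add: mult.assoc)
qed

end
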